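(* Let $V=\bigoplus_{i\in\mathbb Z}V_i$ be a $\mathbb Z$-graded real vector space of finite graded dimension (i.e. $\dim V_i<\infty$ for all $i$), and let $A=\bigoplus_rA_r$, $F$, $F_{pol}$ be the associated graded algebra and its two filtrations (as defined in the context). Then for every $r\in\mathbb Z$ one has $F_{pol}\le F$ on $A_r$. The reverse inequality does not hold in general: there exist a $\mathbb Z$-graded vector space $V$ of finite graded dimension and an $r\in\mathbb Z$ such that $F\le F_{pol}$ fails on $A_r$.
   Context: Let $C=C^\infty(V_0)$, and for $i\in\mathbb Z\setminus\{0\}$ let $\mathcal E_i=C\otimes_{\mathbb R}V_i$, placed in weight $i$. Define $$A=\mathrm{Sym}_{C}\Big(\bigoplus_{i\ne0}\mathcal E_i\Big)=T_{C}\Big(\bigoplus_{i\neq 0}\mathcal E_i\Big)\Big/\big\langle v_1\otimes v_2-(-1)^{p(v_1)p(v_2)}v_2\otimes v_1\big\rangle,$$ where $p(v)\in\mathbb Z_2$ is the weight of $v$ modulo $2$ and $C$ has weight $0$. Then $A=\bigoplus_{r\in\mathbb Z}A_r$, where $A_r$ is the component of total weight $r$. Filtrations, indexed by $p\in\mathbb N_0$: $F^pA$ is the graded ideal generated by all homogeneous elements of weight $\ge p$ for $p\geq 1$, with $F^0A=A$; $F_{pol}^pA=\mathcal I^p$, where $\mathcal I$ is the ideal generated by $\bigoplus_{i\ne0}A_i$, with $F_{pol}^0A=A$. On $A_r$ one uses the induced filtrations $F^pA_r=F^pA\cap A_r$ and $F_{pol}^pA_r=F_{pol}^pA\cap A_r$.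 For two decreasing filtrations $F_1,F_2$ (indexed by $\mathbb N_0$) of a module $N$, $F_1\le F_2$ means that there is a monotonically increasing (non-strictly), unbounded sequence $(l_k)_{k\ge0}$ in $\mathbb N_0$ with $F_1^kN\subset F_2^{l_k}N$ for all $k\ge0$. *)

theory Defs
  imports
    "HOL-Analysis.Analysis"
    "HOL-Algebra.Free_Abelian_Groups"
    "HOL-Algebra.Module"
    "HOL-Algebra.QuotRing"
    "HOL-Algebra.Ideal_Product"
begin

section \<open>Graded vector spaces of finite graded dimension\<close>

text \<open>
  A graded real vector space is given by its homogeneous components \<open>V i\<close>, each a linear
  subspace of some ambient real vector space. The vector space itself is the external direct sum
  of the \<open>V i\<close>; the subspaces need not be independent inside the ambient space
  (if they are, the external and the internal direct sum agree).
\<close>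

definition graded_vector_space :: "(int \<Rightarrow> 'v::real_vector set) \<Rightarrow> bool" where
  "graded_vector_space V \<longleftrightarrow> (\<forall>i. subspace (V i) \<and> (\<exists>B. finite B \<and> span B = V i))"


section \<open>Smooth functions on a finite-dimensional vector space\<close>

text \<open>
  A finite-dimensional subspace \<open>U\<close> of a \<^class>\<open>real_vector\<close> type carries a canonical topology,
  transported from a coordinate space along a basis. Coordinate vectors are indexed
  by the basis itself; coordinates outside \<open>B\<close> are irrelevant.
\<close>

definition fd_continuous :: "'v::real_vector set \<Rightarrow> ('v \<Rightarrow> real) \<Rightarrow> bool" where
  "fd_continuous U f \<longleftrightarrow>
     (\<forall>B. finite B \<and> independent B \<and> span B = U \<longrightarrow>
        continuous_on UNIV (\<lambda>x :: 'v \<Rightarrow> real. f (\<Sum>b\<in>B. x b *\<^sub>R b)))"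

text \<open>\<open>f\<close> is \<open>C\<^sup>k\<close> when all directional derivatives up to order \<open>k\<close> exist and are continuous.\<close>

primrec fd_Ck :: "'v::real_vector set \<Rightarrow> nat \<Rightarrow> ('v \<Rightarrow> real) \<Rightarrow> bool" where
  "fd_Ck U 0 f \<longleftrightarrow> fd_continuous U f"
| "fd_Ck U (Suc k) f \<longleftrightarrow>
     fd_continuous U f \<and>
     (\<forall>v\<in>U. (\<forall>x\<in>U. (\<lambda>t::real. f (x + t *\<^sub>R v)) differentiable (at 0)) \<and>
             fd_Ck U k (\<lambda>x. deriv (\<lambda>t::real. f (x + t *\<^sub>R v)) 0))"

definition smooth_ring :: "'v::real_vector set \<Rightarrow> ('v \<Rightarrow> real) ring" where
  "smooth_ring U =
     \<lparr>carrier = {f \<in> extensional U. \<forall>k. fd_Ck U k f},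
      mult = (\<lambda>f g. \<lambda>x\<in>U. f x * g x),
      one = (\<lambda>x\<in>U. 1),
      zero = (\<lambda>x\<in>U. 0),
      add = (\<lambda>f g. \<lambda>x\<in>U. f x + g x)\<rparr>"


section \<open>The module \<open>C \<otimes>\<^sub>\<real> W\<close>\<close>

text \<open>
  With \<open>C\<close> the smooth functions on \<open>U\<close>, the tensor product \<open>C \<otimes>\<^sub>\<real> W\<close> is the free abelian group
  on \<open>C \<times> W\<close> modulo the bilinearity relations; \<open>C\<close> acts on the first factor.
  The ring-multiplication fields of a module record carry no meaning and are left undefined.
\<close>

definition tensor_relations ::
    "'v::real_vector set \<Rightarrow> 'v set \<Rightarrow> (('v \<Rightarrow> real) \<times> 'v \<Rightarrow>\<^sub>0 int) set" where
  "tensor_relations U W =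
     (let C = smooth_ring U in
       {frag_of (c \<oplus>\<^bsub>C\<^esub> d, w) - frag_of (c, w) - frag_of (d, w) | c d w.
          c \<in> carrier C \<and> d \<in> carrier C \<and> w \<in> W} \<union>
       {frag_of (c, v + w) - frag_of (c, v) - frag_of (c, w) | c v w.
          c \<in> carrier C \<and> v \<in> W \<and> w \<in> W} \<union>
       {frag_of (\<lambda>x\<in>U. a * c x, w) - frag_of (c, a *\<^sub>R w) | (a::real) c w.
          c \<in> carrier C \<and> w \<in> W})"

definition tensor_module ::
    "'v::real_vector set \<Rightarrow> 'v set \<Rightarrow> ('v \<Rightarrow> real, (('v \<Rightarrow> real) \<times> 'v \<Rightarrow>\<^sub>0 int) set) module" where
  "tensor_module U W =
     (let C = smooth_ring U;
          G = free_Abelian_group (carrier C \<times> W);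
          H = generate G (tensor_relations U W)
      in \<lparr>carrier = carrier (G Mod H),
          mult = undefined,
          one = undefined,
          zero = \<one>\<^bsub>G Mod H\<^esub>,
          add = (\<otimes>\<^bsub>G Mod H\<^esub>),
          smult = (\<lambda>c X. \<Union>x\<in>X. H #>\<^bsub>G\<^esub> frag_extend (\<lambda>(d, w). frag_of (c \<otimes>\<^bsub>C\<^esub> d, w)) x)\<rparr>)"


section \<open>Direct sums of modules\<close>

definition direct_sum :: "'i set \<Rightarrow> ('i \<Rightarrow> ('c, 'm) module) \<Rightarrow> ('c, 'i \<Rightarrow> 'm) module" where
  "direct_sum I M =
     \<lparr>carrier = {e \<in> (\<Pi>\<^sub>E i\<in>I. carrier (M i)). finite {i \<in> I. e i \<noteq> \<zero>\<^bsub>M i\<^esub>}},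
      mult = undefined,
      one = undefined,
      zero = (\<lambda>i\<in>I. \<zero>\<^bsub>M i\<^esub>),
      add = (\<lambda>e f. \<lambda>i\<in>I. e i \<oplus>\<^bsub>M i\<^esub> f i),
      smult = (\<lambda>c e. \<lambda>i\<in>I. c \<odot>\<^bsub>M i\<^esub> e i)\<rparr>"


section \<open>The tensor algebra of a module over a commutative ring\<close>

text \<open>
  The free algebra \<open>C\<langle>X\<rangle>\<close>: finitely supported \<open>C\<close>-valued functions on the words over \<open>X\<close>,
  with the concatenation product; the coefficients commute with the letters.
\<close>

definition free_algebra :: "('c, 'b) ring_scheme \<Rightarrow> 'x set \<Rightarrow> ('x list \<Rightarrow> 'c) ring" where
  "free_algebra C X =
     \<lparr>carrier = {f. (\<forall>w. f w \<in> carrier C) \<and> finite {w. f w \<noteq> \<zero>\<^bsub>C\<^esub>} \<and>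
                    {w. f w \<noteq> \<zero>\<^bsub>C\<^esub>} \<subseteq> lists X},
      mult = (\<lambda>f g w. \<Oplus>\<^bsub>C\<^esub>k\<in>{..length w}. f (take k w) \<otimes>\<^bsub>C\<^esub> g (drop k w)),
      one = (\<lambda>w. if w = [] then \<one>\<^bsub>C\<^esub> else \<zero>\<^bsub>C\<^esub>),
      zero = (\<lambda>w. \<zero>\<^bsub>C\<^esub>),
      add = (\<lambda>f g w. f w \<oplus>\<^bsub>C\<^esub> g w)\<rparr>"

definition free_const :: "('c, 'b) ring_scheme \<Rightarrow> 'c \<Rightarrow> 'x list \<Rightarrow> 'c" where
  "free_const C c = (\<lambda>w. if w = [] then c else \<zero>\<^bsub>C\<^esub>)"

definition free_gen :: "('c, 'b) ring_scheme \<Rightarrow> 'x \<Rightarrow> 'x list \<Rightarrow> 'c" where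
  "free_gen C x = (\<lambda>w. if w = [x] then \<one>\<^bsub>C\<^esub> else \<zero>\<^bsub>C\<^esub>)"

text \<open>
  \<open>T\<^sub>C(M)\<close> is the free algebra on the underlying set of \<open>M\<close> modulo the two-sided ideal that makes
  \<open>m \<mapsto> [m]\<close> a \<open>C\<close>-linear map.
\<close>

definition tensor_ideal :: "('c, 'b) ring_scheme \<Rightarrow> ('c, 'm) module \<Rightarrow> ('m list \<Rightarrow> 'c) set" where
  "tensor_ideal C M =
     (let R = free_algebra C (carrier M) in
       Idl\<^bsub>R\<^esub>
        ({free_gen C (m \<oplus>\<^bsub>M\<^esub> n) \<ominus>\<^bsub>R\<^esub> (free_gen C m \<oplus>\<^bsub>R\<^esub> free_gen C n) | m n.
            m \<in> carrier M \<and> n \<in> carrier M} \<union>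
         {free_gen C (c \<odot>\<^bsub>M\<^esub> m) \<ominus>\<^bsub>R\<^esub> free_const C c \<otimes>\<^bsub>R\<^esub> free_gen C m | c m.
            c \<in> carrier C \<and> m \<in> carrier M}))"

definition tensor_algebra :: "('c, 'b) ring_scheme \<Rightarrow> ('c, 'm) module \<Rightarrow> ('m list \<Rightarrow> 'c) set ring" where
  "tensor_algebra C M = free_algebra C (carrier M) Quot tensor_ideal C M"

definition tensor_const ::
    "('c, 'b) ring_scheme \<Rightarrow> ('c, 'm) module \<Rightarrow> 'c \<Rightarrow> ('m list \<Rightarrow> 'c) set" where
  "tensor_const C M c = tensor_ideal C M +>\<^bsub>free_algebra C (carrier M)\<^esub> free_const C c"

definition tensor_gen ::
    "('c, 'b) ring_scheme \<Rightarrow> ('c, 'm) module \<Rightarrow> 'm \<Rightarrow> ('m list \<Rightarrow> 'c) set" where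
  "tensor_gen C M m = tensor_ideal C M +>\<^bsub>free_algebra C (carrier M)\<^esub> free_gen C m"


section \<open>The graded symmetric algebra \<open>A\<close>\<close>

type_synonym 'v fn = "'v \<Rightarrow> real"
type_synonym 'v mod_elem = "int \<Rightarrow> ('v fn \<times> 'v \<Rightarrow>\<^sub>0 int) set"
type_synonym 'v tens = "('v mod_elem list \<Rightarrow> 'v fn) set"

abbreviation coeff_ring :: "(int \<Rightarrow> 'v::real_vector set) \<Rightarrow> 'v fn ring" where
  "coeff_ring V \<equiv> smooth_ring (V 0)"

definition gen_module :: "(int \<Rightarrow> 'v::real_vector set) \<Rightarrow> ('v fn, 'v mod_elem) module" where
  "gen_module V = direct_sum (- {0}) (\<lambda>i. tensor_module (V 0) (V i))"

definition gen_component :: "(int \<Rightarrow> 'v::real_vector set) \<Rightarrow> int \<Rightarrow> 'v mod_elem set" where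
  "gen_component V i =
     {e \<in> carrier (gen_module V). \<forall>j. j \<noteq> 0 \<and> j \<noteq> i \<longrightarrow> e j = \<zero>\<^bsub>tensor_module (V 0) (V j)\<^esub>}"

abbreviation gen_tensor_algebra :: "(int \<Rightarrow> 'v::real_vector set) \<Rightarrow> 'v tens ring" where
  "gen_tensor_algebra V \<equiv> tensor_algebra (coeff_ring V) (gen_module V)"

definition symmetry_ideal :: "(int \<Rightarrow> 'v::real_vector set) \<Rightarrow> 'v tens set" where
  "symmetry_ideal V =
     (let T = gen_tensor_algebra V;
          g = tensor_gen (coeff_ring V) (gen_module V)
      in Idl\<^bsub>T\<^esub>
           {g v \<otimes>\<^bsub>T\<^esub> g w \<ominus>\<^bsub>T\<^esub>
              ((\<ominus>\<^bsub>T\<^esub> \<one>\<^bsub>T\<^esub>) [^]\<^bsub>T\<^esub> nat ((i mod 2) * (j mod 2))) \<otimes>\<^bsub>T\<^esub> (g w \<otimes>\<^bsub>T\<^esub> g v) | v w i j.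
              i \<noteq> 0 \<and> j \<noteq> 0 \<and> v \<in> gen_component V i \<and> w \<in> gen_component V j})"

definition sym_algebra :: "(int \<Rightarrow> 'v::real_vector set) \<Rightarrow> 'v tens set ring" where
  "sym_algebra V = gen_tensor_algebra V Quot symmetry_ideal V"

definition sym_const :: "(int \<Rightarrow> 'v::real_vector set) \<Rightarrow> 'v fn \<Rightarrow> 'v tens set" where
  "sym_const V c =
     symmetry_ideal V +>\<^bsub>gen_tensor_algebra V\<^esub> tensor_const (coeff_ring V) (gen_module V) c"

definition sym_gen :: "(int \<Rightarrow> 'v::real_vector set) \<Rightarrow> 'v mod_elem \<Rightarrow> 'v tens set" where
  "sym_gen V e =
     symmetry_ideal V +>\<^bsub>gen_tensor_algebra V\<^esub> tensor_gen (coeff_ring V) (gen_module V) e"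

text \<open>
  \<open>A\<^sub>r\<close> consists of the finite sums of products \<open>c e\<^sub>1 \<cdots> e\<^sub>n\<close> with \<open>c \<in> C\<close> and \<open>e\<^sub>k\<close> homogeneous
  of weight \<open>i\<^sub>k \<noteq> 0\<close>, where \<open>i\<^sub>1 + \<cdots> + i\<^sub>n = r\<close>. The list \<open>xs\<close> holds the pairs \<open>(i\<^sub>k, e\<^sub>k)\<close>.
\<close>

definition weight_monomials :: "(int \<Rightarrow> 'v::real_vector set) \<Rightarrow> int \<Rightarrow> 'v tens set set" where
  "weight_monomials V r =
     {sym_const V c \<otimes>\<^bsub>sym_algebra V\<^esub>
        foldr (\<lambda>(i, e) a. sym_gen V e \<otimes>\<^bsub>sym_algebra V\<^esub> a) xs \<one>\<^bsub>sym_algebra V\<^esub> | c xs.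
        c \<in> carrier (coeff_ring V) \<and>
        (\<forall>(i, e)\<in>set xs. i \<noteq> 0 \<and> e \<in> gen_component V i) \<and>
        sum_list (map fst xs) = r}"

definition weight_component :: "(int \<Rightarrow> 'v::real_vector set) \<Rightarrow> int \<Rightarrow> 'v tens set set" where
  "weight_component V r = generate (add_monoid (sym_algebra V)) (weight_monomials V r)"


section \<open>Filtrations\<close>

definition weight_filtration :: "(int \<Rightarrow> 'v::real_vector set) \<Rightarrow> nat \<Rightarrow> 'v tens set set" where
  "weight_filtration V p =
     (if p = 0 then carrier (sym_algebra V)
      else Idl\<^bsub>sym_algebra V\<^esub> (\<Union>r\<in>{int p..}. weight_component V r))"

definition nonzero_weight_ideal :: "(int \<Rightarrow> 'v::real_vector set) \<Rightarrow> 'v tens set set" where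
  "nonzero_weight_ideal V = Idl\<^bsub>sym_algebra V\<^esub> (\<Union>i\<in>- {0}. weight_component V i)"

text \<open>In \<^const>\<open>ideals_set\<close> the zeroth power of an ideal is the whole ring.\<close>

definition pol_filtration :: "(int \<Rightarrow> 'v::real_vector set) \<Rightarrow> nat \<Rightarrow> 'v tens set set" where
  "pol_filtration V p = nonzero_weight_ideal V [^]\<^bsub>ideals_set (sym_algebra V)\<^esub> p"

definition induced_filtration :: "(nat \<Rightarrow> 'a set) \<Rightarrow> 'a set \<Rightarrow> nat \<Rightarrow> 'a set" where
  "induced_filtration F N = (\<lambda>p. F p \<inter> N)"

definition filtration_le :: "(nat \<Rightarrow> 'a set) \<Rightarrow> (nat \<Rightarrow> 'a set) \<Rightarrow> bool" where
  "filtration_le F G \<longleftrightarrow>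
     (\<exists>l :: nat \<Rightarrow> nat. mono l \<and> \<not> bdd_above (range l) \<and> (\<forall>k. F k \<subseteq> G (l k)))"

end

(*
  A monomial of total weight r with at least k letters contains letters of positive weight adding
  up to at least (k + r) / 2; up to sign they can be moved to the front, where they form a factor
  of that weight. An element of I^k that lies in A_r is a sum of monomials with at least k letters,
  but a priori of arbitrary weights. The weight components are eigenspaces of the endomorphism
  that multiplies generators of weight i by 2^i, hence independent, so only monomials of weight r
  contribute. This gives l_k = (k + r) div 2.

  Conversely, let every V_i be the real line. For even k > 0 the product of generators of weights
  k and -k lies in F^k and has weight 0. Evaluating coefficients at 0 and sending these two
  generators to X and all others to 0 defines a homomorphism to R[X], because only even weights
  survive. It maps I^3 into (X^3) and the product to X^2, so the product is never in I^3.
*)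

theory Submission
  imports Defs "HOL-Algebra.UnivPoly"
begin


text \<open>\<open>sym_algebra V\<close> is a quotient of a quotient of a free algebra, so its
  elements have no normal form, and neither a basis nor freeness over \<open>C\<close> is
  established. Membership of an element in a span of monomials can be computed directly.
  Independence, or failure of membership, cannot; it has to be read off a ring homomorphism out of
  \<open>A\<close>. This makes \<open>sym_algebra_universal\<close> the central tool. It is applied
  with target \<open>A\<close> for the eigenspace argument and with target R[X] for the
  counterexample. The base 2 serves because its integer powers are pairwise distinct: the
  differences 2^t - 2^s for distinct s, t are nonzero real constants, hence units of
  \<open>C\<close>, and the usual elimination of eigenvectors works although \<open>A\<close> is
  only a ring. The restriction to even weights in the counterexample is forced by the target: a
  generator v of odd weight satisfies v v = - v v, so its image in a domain of characteristic 0
  vanishes.\<close>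

section \<open>Smooth functions on a linear subspace form a commutative ring\<close>

lemma fd_continuous_cong:
  assumes "\<And>x. x \<in> U \<Longrightarrow> f x = g x"
  shows "fd_continuous U f \<longleftrightarrow> fd_continuous U g"
proof -
  have "f (\<Sum>b\<in>B. x b *\<^sub>R b) = g (\<Sum>b\<in>B. x b *\<^sub>R b)" if "span B = U" for B and x :: "'a \<Rightarrow> real"
    by (rule assms, subst that[symmetric]) (intro span_sum span_scale span_base)
  then show ?thesis
    unfolding fd_continuous_def by (auto cong: continuous_on_cong)
qed

text \<open>A line x + t v with x and v in the subspace \<open>U\<close> stays in \<open>U\<close>,
  so the derivatives see only values on \<open>U\<close>. This permits passing between a function
  and its restriction, which is \<open>undefined\<close> off \<open>U\<close>.\<close>

lemma fd_Ck_cong: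
  assumes U: "subspace U" and "\<And>x. x \<in> U \<Longrightarrow> f x = g x"
  shows "fd_Ck U k f \<longleftrightarrow> fd_Ck U k g"
  using assms(2)
proof (induction k arbitrary: f g)
  case 0
  show ?case using fd_continuous_cong[OF 0] by simp
next
  case (Suc k)
  have line: "(\<lambda>t::real. f (x + t *\<^sub>R v)) = (\<lambda>t. g (x + t *\<^sub>R v))" if "x \<in> U" "v \<in> U" for x v
    using Suc.prems U that by (auto simp: subspace_add subspace_scale)
  have "fd_Ck U k (\<lambda>x. deriv (\<lambda>t. f (x + t *\<^sub>R v)) 0) = fd_Ck U k (\<lambda>x. deriv (\<lambda>t. g (x + t *\<^sub>R v)) 0)"
    if "v \<in> U" for v
    by (rule Suc.IH) (simp add: line that)
  then show ?case
    using fd_continuous_cong[of U f g, OF Suc.prems] line by simp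
qed

lemma fd_Ck_Suc_imp: "fd_Ck U (Suc k) f \<Longrightarrow> fd_Ck U k f"
proof (induction k arbitrary: f)
  case (Suc k)
  have "fd_Ck U k (\<lambda>x. deriv (\<lambda>t. f (x + t *\<^sub>R v)) 0)" if "v \<in> U" for v
    by (rule Suc.IH) (use Suc.prems that in auto)
  then show ?case using Suc.prems by simp
qed simp

lemma fd_Ck_const: "fd_Ck U k (\<lambda>x. a)"
  by (induction k arbitrary: a) (auto simp: fd_continuous_def)

lemma fd_Ck_add:
  assumes U: "subspace U"
  shows "fd_Ck U k f \<Longrightarrow> fd_Ck U k g \<Longrightarrow> fd_Ck U k (\<lambda>x. f x + g x)"
proof (induction k arbitrary: f g)
  case 0
  then show ?case by (auto simp: fd_continuous_def intro!: continuous_on_add)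
next
  case (Suc k)
  have D: "((\<lambda>t. f (x + t *\<^sub>R v)) has_real_derivative deriv (\<lambda>t. f (x + t *\<^sub>R v)) 0) (at 0)"
          "((\<lambda>t. g (x + t *\<^sub>R v)) has_real_derivative deriv (\<lambda>t. g (x + t *\<^sub>R v)) 0) (at 0)"
    if "x \<in> U" "v \<in> U" for x v
    using Suc.prems that by (auto simp: DERIV_deriv_iff_real_differentiable)
  have S: "((\<lambda>t. f (x + t *\<^sub>R v) + g (x + t *\<^sub>R v)) has_real_derivative deriv (\<lambda>t. f (x + t *\<^sub>R v)) 0 + deriv (\<lambda>t. g (x + t *\<^sub>R v)) 0) (at 0)"
    if "x \<in> U" "v \<in> U" for x v
    using DERIV_add[OF D[OF that]] by simp
  have "fd_Ck U k (\<lambda>x. deriv (\<lambda>t. f (x + t *\<^sub>R v) + g (x + t *\<^sub>R v)) 0)" if v: "v \<in> U" for v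
  proof -
    have "fd_Ck U k (\<lambda>x. deriv (\<lambda>t. f (x + t *\<^sub>R v)) 0 + deriv (\<lambda>t. g (x + t *\<^sub>R v)) 0)"
      by (rule Suc.IH) (use Suc.prems v in auto)
    then show ?thesis
      by (subst fd_Ck_cong[OF U]) (use S[OF _ v] in \<open>auto simp: DERIV_imp_deriv\<close>)
  qed
  moreover have "fd_continuous U (\<lambda>x. f x + g x)"
    using Suc.prems by (auto simp: fd_continuous_def intro!: continuous_on_add)
  moreover have "(\<lambda>t. f (x + t *\<^sub>R v) + g (x + t *\<^sub>R v)) differentiable at 0" if "x \<in> U" "v \<in> U" for x v
    using S[OF that] unfolding real_differentiable_def by blast
  ultimately show ?case by simp
qed

lemma fd_Ck_mult:
  assumes U: "subspace U"
  shows "fd_Ck U k f \<Longrightarrow> fd_Ck U k g \<Longrightarrow> fd_Ck U k (\<lambda>x. f x * g x)"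
proof (induction k arbitrary: f g)
  case 0
  then show ?case by (auto simp: fd_continuous_def intro!: continuous_on_mult)
next
  case (Suc k)
  have D: "((\<lambda>t. f (x + t *\<^sub>R v)) has_real_derivative deriv (\<lambda>t. f (x + t *\<^sub>R v)) 0) (at 0)"
          "((\<lambda>t. g (x + t *\<^sub>R v)) has_real_derivative deriv (\<lambda>t. g (x + t *\<^sub>R v)) 0) (at 0)"
    if "x \<in> U" "v \<in> U" for x v
    using Suc.prems that by (auto simp: DERIV_deriv_iff_real_differentiable)
  have S: "((\<lambda>t. f (x + t *\<^sub>R v) * g (x + t *\<^sub>R v)) has_real_derivative deriv (\<lambda>t. f (x + t *\<^sub>R v)) 0 * g x + deriv (\<lambda>t. g (x + t *\<^sub>R v)) 0 * f x) (at 0)"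
    if "x \<in> U" "v \<in> U" for x v
    using DERIV_mult[OF D[OF that]] by simp
  have "fd_Ck U k (\<lambda>x. deriv (\<lambda>t. f (x + t *\<^sub>R v) * g (x + t *\<^sub>R v)) 0)" if v: "v \<in> U" for v
  proof -
    \<comment> \<open>The product rule leaves one factor undifferentiated in each summand;
      \<open>fd_Ck_Suc_imp\<close> lowers its order from \<open>Suc k\<close> to \<open>k\<close>,
      as the induction hypothesis requires.\<close>
    have "fd_Ck U k (\<lambda>x. deriv (\<lambda>t. f (x + t *\<^sub>R v)) 0 * g x + deriv (\<lambda>t. g (x + t *\<^sub>R v)) 0 * f x)"
      by (intro fd_Ck_add[OF U] Suc.IH) (use Suc.prems v fd_Ck_Suc_imp in auto)
    then show ?thesis
      by (subst fd_Ck_cong[OF U]) (use S[OF _ v] in \<open>auto simp: DERIV_imp_deriv\<close>)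
  qed
  moreover have "fd_continuous U (\<lambda>x. f x * g x)"
    using Suc.prems by (auto simp: fd_continuous_def intro!: continuous_on_mult)
  moreover have "(\<lambda>t. f (x + t *\<^sub>R v) * g (x + t *\<^sub>R v)) differentiable at 0" if "x \<in> U" "v \<in> U" for x v
    using S[OF that] unfolding real_differentiable_def by blast
  ultimately show ?case by simp
qed

lemma smooth_ring_ops:
  "f \<oplus>\<^bsub>smooth_ring U\<^esub> g = (\<lambda>x\<in>U. f x + g x)"
  "f \<otimes>\<^bsub>smooth_ring U\<^esub> g = (\<lambda>x\<in>U. f x * g x)"
  "\<zero>\<^bsub>smooth_ring U\<^esub> = (\<lambda>x\<in>U. 0)"
  "\<one>\<^bsub>smooth_ring U\<^esub> = (\<lambda>x\<in>U. 1)"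
  by (simp_all add: smooth_ring_def)

lemma smooth_ring_extensional: "f \<in> carrier (smooth_ring U) \<Longrightarrow> f \<in> extensional U"
  by (simp add: smooth_ring_def)

lemma smooth_ring_carrier_restrict:
  assumes "subspace U" "\<And>k. fd_Ck U k f"
  shows "(\<lambda>x\<in>U. f x) \<in> carrier (smooth_ring U)"
  using assms fd_Ck_cong[OF assms(1), of "\<lambda>x\<in>U. f x" f] by (auto simp: smooth_ring_def)

lemma smooth_ring_CkD: "f \<in> carrier (smooth_ring U) \<Longrightarrow> fd_Ck U k f"
  by (simp add: smooth_ring_def)

lemma smooth_ring_const:
  "subspace U \<Longrightarrow> (\<lambda>x\<in>U. a) \<in> carrier (smooth_ring U)"
  by (intro smooth_ring_carrier_restrict fd_Ck_const)

lemma smooth_ring_add_closed: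
  assumes U: "subspace U" and "f \<in> carrier (smooth_ring U)" "g \<in> carrier (smooth_ring U)"
  shows "(\<lambda>x\<in>U. f x + g x) \<in> carrier (smooth_ring U)"
  by (rule smooth_ring_carrier_restrict[OF U] fd_Ck_add[OF U] smooth_ring_CkD assms)+

lemma smooth_ring_mult_closed:
  assumes U: "subspace U" and "f \<in> carrier (smooth_ring U)" "g \<in> carrier (smooth_ring U)"
  shows "(\<lambda>x\<in>U. f x * g x) \<in> carrier (smooth_ring U)"
  by (rule smooth_ring_carrier_restrict[OF U] fd_Ck_mult[OF U] smooth_ring_CkD assms)+

lemma smooth_ring_cring:
  assumes U: "subspace U"
  shows "cring (smooth_ring U)"
proof (rule cringI)
  note closed = smooth_ring_add_closed[OF U] smooth_ring_mult_closed[OF U] smooth_ring_const[OF U]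
  \<comment> \<open>The operations restrict to \<open>U\<close>, so laws such as 0 + f = f compare
    values off \<open>U\<close> as well; there both sides are \<open>undefined\<close>.\<close>
  have undef: "f x = undefined" if "f \<in> carrier (smooth_ring U)" "x \<notin> U" for f x
    using smooth_ring_extensional[OF that(1)] that(2) by (rule extensional_arb)
  show "abelian_group (smooth_ring U)"
  proof (rule abelian_groupI)
    show "\<exists>g\<in>carrier (smooth_ring U). g \<oplus>\<^bsub>smooth_ring U\<^esub> f = \<zero>\<^bsub>smooth_ring U\<^esub>"
      if f: "f \<in> carrier (smooth_ring U)" for f
    proof (rule bexI)
      \<comment> \<open>The negative is written as the product with the constant -1, so that closure
        under products and constants gives its smoothness.\<close>
      show "(\<lambda>x\<in>U. (\<lambda>x\<in>U. -1) x * f x) \<in> carrier (smooth_ring U)"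
        by (intro closed f)
    qed (simp add: smooth_ring_ops fun_eq_iff)
  qed (simp_all only: smooth_ring_ops closed fun_eq_iff, simp_all add: undef)
  show "comm_monoid (smooth_ring U)"
    by (rule comm_monoidI)
      (simp_all only: smooth_ring_ops closed fun_eq_iff, simp_all add: undef)
qed (simp add: smooth_ring_ops algebra_simps fun_eq_iff)


section \<open>Tensor products and direct sums as modules\<close>

text \<open>Serves to move the group laws from \<open>G Mod H\<close> to the additive part of the
  module record, which has the same operations but is a different record.\<close>

lemma comm_group_cong:
  assumes "comm_group A" and "carrier B = carrier A"
    and "\<And>x y. x \<otimes>\<^bsub>B\<^esub> y = x \<otimes>\<^bsub>A\<^esub> y" "\<one>\<^bsub>B\<^esub> = \<one>\<^bsub>A\<^esub>"
  shows "comm_group B"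
proof -
  interpret A: comm_group A by fact
  show ?thesis
    by (rule comm_groupI) (use A.l_inv_ex in \<open>auto simp: assms A.m_ac\<close>)
qed

locale tensor_pair =
  fixes U W :: "'v::real_vector set"
  assumes U: "subspace U" and W: "subspace W"
begin

abbreviation "C \<equiv> smooth_ring U"
abbreviation "G \<equiv> free_Abelian_group (carrier C \<times> W)"
abbreviation "H \<equiv> generate G (tensor_relations U W)"
abbreviation "M \<equiv> tensor_module U W"

text \<open>The action on representatives from which \<open>smult\<close> of
  \<open>tensor_module\<close> is built. It is defined on the whole free abelian group, before the
  relations are imposed.\<close>

definition scale :: "('v \<Rightarrow> real) \<Rightarrow> (('v \<Rightarrow> real) \<times> 'v \<Rightarrow>\<^sub>0 int) \<Rightarrow> (('v \<Rightarrow> real) \<times> 'v \<Rightarrow>\<^sub>0 int)" where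
  "scale c = frag_extend (\<lambda>(d, w). frag_of (c \<otimes>\<^bsub>C\<^esub> d, w))"

text \<open>The elementary tensor of \<open>c\<close> and \<open>w\<close>, as a coset.\<close>

definition pure :: "('v \<Rightarrow> real) \<Rightarrow> 'v \<Rightarrow> (('v \<Rightarrow> real) \<times> 'v \<Rightarrow>\<^sub>0 int) set" where
  "pure c w = H #>\<^bsub>G\<^esub> frag_of (c, w)"

sublocale C: cring C by (rule smooth_ring_cring[OF U])
sublocale G: comm_group G by (rule abelian_free_Abelian_group)

lemma carrier_G_add: "x \<in> carrier G \<Longrightarrow> y \<in> carrier G \<Longrightarrow> x + y \<in> carrier G"
  using G.m_closed[of x y] by simp

lemma carrier_G_diff: "x \<in> carrier G \<Longrightarrow> y \<in> carrier G \<Longrightarrow> x - y \<in> carrier G"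
  using G.m_closed[of x "inv\<^bsub>G\<^esub> y"] by simp

lemma smult_const_closed: "c \<in> carrier C \<Longrightarrow> (\<lambda>x\<in>U. a * c x) \<in> carrier C"
  using smooth_ring_mult_closed[OF U smooth_ring_const[OF U, of a], of c]
  by (simp cong: restrict_cong)

lemma relations_subset: "tensor_relations U W \<subseteq> carrier G"
proof
  fix x assume "x \<in> tensor_relations U W"
  then show "x \<in> carrier G"
    unfolding tensor_relations_def Let_def
    by (auto simp del: carrier_free_Abelian_group_iff intro!: carrier_G_diff
        simp: subspace_add[OF W] subspace_scale[OF W] smult_const_closed)
qed

lemma H_subgroup: "subgroup H G"
  by (rule G.generate_is_subgroup[OF relations_subset])

sublocale N: normal H G
  by (rule G.subgroup_imp_normal[OF H_subgroup])

lemma coset_eqI: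
  assumes "x \<in> carrier G" "y \<in> carrier G" "x - y \<in> H"
  shows "H #>\<^bsub>G\<^esub> x = H #>\<^bsub>G\<^esub> y"
proof -
  have "x \<in> H #>\<^bsub>G\<^esub> y"
    by (rule N.rcos_module_rev) (use assms in auto)
  then show ?thesis
    using G.repr_independence[OF _ assms(2) H_subgroup] by simp
qed

lemma H_add: "x \<in> H \<Longrightarrow> y \<in> H \<Longrightarrow> x + y \<in> H"
  using N.m_closed by simp

lemma H_diff: "x \<in> H \<Longrightarrow> y \<in> H \<Longrightarrow> x - y \<in> H"
  using N.m_closed[OF _ N.m_inv_closed, of x y] subsetD[OF N.subset, of y] by simp

lemma H_zero: "0 \<in> H"
  using N.one_closed by simp

lemma scale_closed:
  assumes "c \<in> carrier C" "x \<in> carrier G"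
  shows "scale c x \<in> carrier G"
proof -
  have "Poly_Mapping.keys (case p of (d, w) \<Rightarrow> frag_of (c \<otimes>\<^bsub>C\<^esub> d, w)) \<subseteq> carrier C \<times> W" if "p \<in> Poly_Mapping.keys x" for p
    using that assms by (cases p) auto
  then show ?thesis
    using keys_frag_extend[of "\<lambda>(d, w). frag_of (c \<otimes>\<^bsub>C\<^esub> d, w)" x]
    unfolding scale_def carrier_free_Abelian_group_iff by blast
qed

lemma scale_simps [simp]:
  "scale c (frag_of (d, w)) = frag_of (c \<otimes>\<^bsub>C\<^esub> d, w)" "scale c 0 = 0"
  "scale c (x + y) = scale c x + scale c y" "scale c (x - y) = scale c x - scale c y"
  "scale c (- x) = - scale c x"
  by (simp_all add: scale_def frag_extend_add frag_extend_diff frag_extend_minus)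

text \<open>Multiplying the first entries by \<open>c\<close> maps each of the three families of
  relations into itself: the first by distributivity, the third because real factors commute with
  \<open>c\<close>. Hence \<open>H\<close> is stable under \<open>scale c\<close> and the action
  descends to cosets.\<close>

lemma scale_relation:
  assumes c: "c \<in> carrier C" and "x \<in> tensor_relations U W"
  shows "scale c x \<in> tensor_relations U W"
proof -
  have ac: "c \<otimes>\<^bsub>C\<^esub> (\<lambda>x\<in>U. a * d x) = (\<lambda>x\<in>U. a * (c \<otimes>\<^bsub>C\<^esub> d) x)" for a d
    by (simp add: smooth_ring_ops fun_eq_iff)
  from assms(2) consider
      (left) d e w where "x = frag_of (d \<oplus>\<^bsub>C\<^esub> e, w) - frag_of (d, w) - frag_of (e, w)"
        "d \<in> carrier C" "e \<in> carrier C" "w \<in> W"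
    | (right) d v w where "x = frag_of (d, v + w) - frag_of (d, v) - frag_of (d, w)"
        "d \<in> carrier C" "v \<in> W" "w \<in> W"
    | (balanced) a d w where "x = frag_of (\<lambda>x\<in>U. a * d x, w) - frag_of (d, a *\<^sub>R w)"
        "d \<in> carrier C" "w \<in> W"
    unfolding tensor_relations_def Let_def by blast
  then show ?thesis
  proof cases
    case left
    then show ?thesis
      using c unfolding tensor_relations_def Let_def by (intro UnI1) (force simp: C.r_distr)
  next
    case right
    then show ?thesis
      using c unfolding tensor_relations_def Let_def by (intro UnI1 UnI2) force
  next
    case balanced
    then show ?thesis
      using c unfolding tensor_relations_def Let_def by (intro UnI2) (force simp: ac)
  qed
qed

lemma scale_H:
  assumes c: "c \<in> carrier C" and "x \<in> H"
  shows "scale c x \<in> H"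
  using assms(2)
proof (induction rule: generate.induct)
  case (inv x)
  then have "scale c x \<in> H" "x \<in> carrier G"
    using scale_relation[OF c] relations_subset by (blast intro: generate.incl)+
  then show ?case
    using H_diff[OF H_zero, of "scale c x"] by simp
qed (use scale_relation[OF c] H_zero H_add in \<open>auto intro: generate.incl\<close>)

lemma tensor_module_carrier: "carrier M = (\<lambda>x. H #>\<^bsub>G\<^esub> x) ` carrier G"
  by (simp add: tensor_module_def Let_def carrier_FactGroup)

lemma tensor_module_add:
  "x \<in> carrier G \<Longrightarrow> y \<in> carrier G \<Longrightarrow> (H #>\<^bsub>G\<^esub> x) \<oplus>\<^bsub>M\<^esub> (H #>\<^bsub>G\<^esub> y) = H #>\<^bsub>G\<^esub> (x + y)"
  using N.rcos_sum[of x y] by (simp add: tensor_module_def Let_def)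

text \<open>The record takes the union of the resulting cosets over all representatives. By
  \<open>scale_H\<close> every representative yields the same coset, so the union collapses to
  it.\<close>

lemma tensor_module_smult:
  assumes "c \<in> carrier C" "x \<in> carrier G"
  shows "c \<odot>\<^bsub>M\<^esub> (H #>\<^bsub>G\<^esub> x) = H #>\<^bsub>G\<^esub> scale c x"
proof -
  have "H #>\<^bsub>G\<^esub> scale c y = H #>\<^bsub>G\<^esub> scale c x" if y: "y \<in> H #>\<^bsub>G\<^esub> x" for y
  proof (rule coset_eqI)
    obtain h where h: "h \<in> H" "y = h + x"
      using y by (auto simp: r_coset_def)
    then have "y \<in> carrier G"
      using N.subset assms(2) carrier_G_add by blast
    then show "scale c y \<in> carrier G" "scale c x \<in> carrier G"
      using assms scale_closed by blast+
    show "scale c y - scale c x \<in> H"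
      using h scale_H[OF assms(1)] by simp
  qed
  moreover have "x \<in> H #>\<^bsub>G\<^esub> x"
    using G.rcos_self[OF assms(2) H_subgroup] .
  ultimately have "(\<Union>y\<in>H #>\<^bsub>G\<^esub> x. H #>\<^bsub>G\<^esub> scale c y) = H #>\<^bsub>G\<^esub> scale c x"
    by blast
  then show ?thesis
    by (simp add: tensor_module_def Let_def scale_def)
qed

lemma pure_closed: "c \<in> carrier C \<Longrightarrow> w \<in> W \<Longrightarrow> pure c w \<in> carrier M"
  by (auto simp: pure_def tensor_module_carrier simp del: carrier_free_Abelian_group_iff)

lemma add_monoid_tensor_module:
  "comm_group (add_monoid M)"
proof -
  have "comm_group (G Mod H)"
    by (rule G.abelian_FactGroup[OF H_subgroup])
  then show ?thesis
    by (rule comm_group_cong) (simp_all add: tensor_module_def Let_def FactGroup_def)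
qed

text \<open>Among the laws of the action, only distributivity over a sum of scalars depends on the
  relations. The others already hold for \<open>scale\<close> on the free abelian group and pass to
  cosets.\<close>

lemma module_tensor_module: "module C M"
proof (rule moduleI)
  show "abelian_group M"
    using add_monoid_tensor_module by (simp add: abelian_group_def abelian_group_axioms_def
        abelian_monoid_def comm_group_def)
  note simps = tensor_module_carrier tensor_module_smult tensor_module_add scale_closed carrier_G_add
  show "a \<odot>\<^bsub>M\<^esub> X \<in> carrier M" if "a \<in> carrier C" "X \<in> carrier M" for a X
    using that by (auto simp: simps simp del: carrier_free_Abelian_group_iff)
  show "(a \<oplus>\<^bsub>C\<^esub> b) \<odot>\<^bsub>M\<^esub> X = a \<odot>\<^bsub>M\<^esub> X \<oplus>\<^bsub>M\<^esub> b \<odot>\<^bsub>M\<^esub> X"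
    if ab: "a \<in> carrier C" "b \<in> carrier C" and X: "X \<in> carrier M" for a b X
  proof -
    obtain x where x: "x \<in> carrier G" "X = H #>\<^bsub>G\<^esub> x"
      using X by (auto simp: tensor_module_carrier)
    \<comment> \<open>For a generator the difference is literally a relation of the first family;
      induction over the free group extends this to all elements.\<close>
    from x(1) have "scale (a \<oplus>\<^bsub>C\<^esub> b) x - (scale a x + scale b x) \<in> H"
      unfolding carrier_free_Abelian_group_iff
    proof (induction rule: frag_induction)
      case (one p)
      obtain c w where p: "p = (c, w)" "c \<in> carrier C" "w \<in> W" using one by blast
      then have "scale (a \<oplus>\<^bsub>C\<^esub> b) (frag_of p) - (scale a (frag_of p) + scale b (frag_of p))
          = frag_of (a \<otimes>\<^bsub>C\<^esub> c \<oplus>\<^bsub>C\<^esub> b \<otimes>\<^bsub>C\<^esub> c, w) - frag_of (a \<otimes>\<^bsub>C\<^esub> c, w) - frag_of (b \<otimes>\<^bsub>C\<^esub> c, w)"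
        using ab by (simp add: C.l_distr)
      also have "\<dots> \<in> tensor_relations U W"
        using ab p unfolding tensor_relations_def Let_def
        by (intro UnI1 CollectI exI[of _ "a \<otimes>\<^bsub>C\<^esub> c"] exI[of _ "b \<otimes>\<^bsub>C\<^esub> c"] exI[of _ w]) simp
      finally show ?case by (rule generate.incl)
    next
      case (diff x y)
      then show ?case
        using H_diff[OF diff] by (simp add: algebra_simps)
    qed (simp add: H_zero)
    then have "H #>\<^bsub>G\<^esub> scale (a \<oplus>\<^bsub>C\<^esub> b) x = H #>\<^bsub>G\<^esub> (scale a x + scale b x)"
      using ab x(1) by (intro coset_eqI carrier_G_add scale_closed) auto
    then show ?thesis
      using ab x by (simp add: tensor_module_smult tensor_module_add scale_closed del: carrier_free_Abelian_group_iff)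
  qed
  show "a \<odot>\<^bsub>M\<^esub> (X \<oplus>\<^bsub>M\<^esub> Y) = a \<odot>\<^bsub>M\<^esub> X \<oplus>\<^bsub>M\<^esub> a \<odot>\<^bsub>M\<^esub> Y"
    if "a \<in> carrier C" "X \<in> carrier M" "Y \<in> carrier M" for a X Y
    using that by (auto simp: simps simp del: carrier_free_Abelian_group_iff)
  show "a \<otimes>\<^bsub>C\<^esub> b \<odot>\<^bsub>M\<^esub> X = a \<odot>\<^bsub>M\<^esub> (b \<odot>\<^bsub>M\<^esub> X)"
    if ab: "a \<in> carrier C" "b \<in> carrier C" and X: "X \<in> carrier M" for a b X
  proof -
    obtain x where x: "x \<in> carrier G" "X = H #>\<^bsub>G\<^esub> x"
      using X by (auto simp: tensor_module_carrier)
    from x(1) have "scale (a \<otimes>\<^bsub>C\<^esub> b) x = scale a (scale b x)"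
      unfolding carrier_free_Abelian_group_iff
      by (induction rule: frag_induction) (use ab in \<open>auto simp: C.m_assoc\<close>)
    then show ?thesis
      using ab x by (simp add: tensor_module_smult scale_closed del: carrier_free_Abelian_group_iff)
  qed
  show "\<one>\<^bsub>C\<^esub> \<odot>\<^bsub>M\<^esub> X = X" if X: "X \<in> carrier M" for X
  proof -
    obtain x where x: "x \<in> carrier G" "X = H #>\<^bsub>G\<^esub> x"
      using X by (auto simp: tensor_module_carrier)
    from x(1) have "scale \<one>\<^bsub>C\<^esub> x = x"
      unfolding carrier_free_Abelian_group_iff
      by (induction rule: frag_induction) auto
    then show ?thesis
      using x by (simp add: tensor_module_smult del: carrier_free_Abelian_group_iff)
  qed
qed (rule C.is_cring)

text \<open>The balanced map extends to the free abelian group, kills each relation and therefore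
  factors through \<open>H\<close>. The target is merely an abelian group, so the conclusion is
  additive; compatibility with an action of \<open>C\<close> has to be proved for each use.\<close>

lemma tensor_module_universal:
  fixes B (structure)
  assumes "abelian_group B"
    and f: "\<And>c w. c \<in> carrier C \<Longrightarrow> w \<in> W \<Longrightarrow> f c w \<in> carrier B"
    and "\<And>c d w. c \<in> carrier C \<Longrightarrow> d \<in> carrier C \<Longrightarrow> w \<in> W \<Longrightarrow> f (c \<oplus>\<^bsub>C\<^esub> d) w = f c w \<oplus> f d w"
    and "\<And>c v w. c \<in> carrier C \<Longrightarrow> v \<in> W \<Longrightarrow> w \<in> W \<Longrightarrow> f c (v + w) = f c v \<oplus> f c w"
    and "\<And>a c w. c \<in> carrier C \<Longrightarrow> w \<in> W \<Longrightarrow> f (\<lambda>x\<in>U. a * c x) w = f c (a *\<^sub>R w)"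
  obtains h where "h \<in> hom (add_monoid M) (add_monoid B)"
    "\<And>c w. c \<in> carrier C \<Longrightarrow> w \<in> W \<Longrightarrow> h (pure c w) = f c w"
proof -
  interpret B: abelian_group B by fact
  obtain k where k: "k \<in> hom G (add_monoid B)"
    and k_of: "\<And>p. p \<in> carrier C \<times> W \<Longrightarrow> k (frag_of p) = (\<lambda>(c, w). f c w) p"
    using B.a_comm_group f
    by (rule_tac comm_group.free_Abelian_group_universal[of "add_monoid B" "\<lambda>(c, w). f c w" "carrier C \<times> W"]) auto
  interpret k: group_hom G "add_monoid B" k
    using k by unfold_locales
  have k_diff: "k (x - y) = k x \<ominus> k y" and k_closed: "k x \<in> carrier B"
    if "x \<in> carrier G" "y \<in> carrier G" for x y
    using k.hom_mult[of x "inv\<^bsub>G\<^esub> y"] k.hom_inv[of y] k.hom_closed[of x] that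
    by (auto simp: a_minus_def a_inv_def)
  have cancel: "x \<oplus> y \<ominus> x \<ominus> y = \<zero>" if "x \<in> carrier B" "y \<in> carrier B" for x y
    using that by (simp add: a_minus_def B.a_comm[of x y] B.a_assoc B.r_neg)
  have rel: "k x = \<zero>" if "x \<in> tensor_relations U W" for x
    using that unfolding tensor_relations_def Let_def
  proof (elim UnE CollectE exE conjE)
    fix c d w assume x: "x = frag_of (c \<oplus>\<^bsub>C\<^esub> d, w) - frag_of (c, w) - frag_of (d, w)"
      and cdw: "c \<in> carrier C" "d \<in> carrier C" "w \<in> W"
    show ?thesis
      unfolding x using cdw assms(3)[OF cdw] f
      by (simp add: k_of k_diff carrier_G_diff cancel del: carrier_free_Abelian_group_iff)
  next
    fix c v w assume x: "x = frag_of (c, v + w) - frag_of (c, v) - frag_of (c, w)"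
      and cvw: "c \<in> carrier C" "v \<in> W" "w \<in> W"
    show ?thesis
      unfolding x using cvw assms(4)[OF cvw] f subspace_add[OF W]
      by (simp add: k_of k_diff carrier_G_diff cancel del: carrier_free_Abelian_group_iff)
  next
    fix a c w assume x: "x = frag_of (\<lambda>x\<in>U. a * c x, w) - frag_of (c, a *\<^sub>R w)"
      and cw: "c \<in> carrier C" "w \<in> W"
    show ?thesis
      unfolding x using cw assms(5)[OF cw] f subspace_scale[OF W] smult_const_closed
      by (simp add: k_of k_diff carrier_G_diff B.r_neg[folded a_minus_def] del: carrier_free_Abelian_group_iff)
  qed
  have ker: "k x = \<zero>" if "x \<in> H" for x
    using that
  proof (induction rule: generate.induct)
    case (inv x)
    then show ?case
      using rel[of x] k.hom_inv[OF subsetD[OF relations_subset], of x] by simp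
  next
    case (eng x y)
    then show ?case
      using k.hom_mult[OF subsetD[OF N.subset] subsetD[OF N.subset], of x y] by simp
  qed (use rel k.hom_one in simp_all)
  have kerH: "H \<subseteq> kernel G (add_monoid B) k"
  proof
    fix x assume "x \<in> H"
    with ker[OF this] subsetD[OF N.subset this] show "x \<in> kernel G (add_monoid B) k"
      by (simp add: kernel_def)
  qed
  obtain h where h: "h \<in> hom (G Mod H) (add_monoid B)" "\<And>x. x \<in> carrier G \<Longrightarrow> h (H #>\<^bsub>G\<^esub> x) = k x"
    using k.FactGroup_universal_kernel[OF N.normal_axioms kerH] by blast
  have "h \<in> hom (add_monoid M) (add_monoid B)"
    using h(1) by (simp add: hom_def tensor_module_def Let_def)
  then show thesis
    by (rule that) (auto simp: pure_def h(2) k_of simp del: carrier_free_Abelian_group_iff)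
qed

end

section \<open>Direct sums: finitely supported families\<close>

lemma direct_sum_simps:
  "e \<oplus>\<^bsub>direct_sum I M\<^esub> f = (\<lambda>i\<in>I. e i \<oplus>\<^bsub>M i\<^esub> f i)"
  "\<zero>\<^bsub>direct_sum I M\<^esub> = (\<lambda>i\<in>I. \<zero>\<^bsub>M i\<^esub>)"
  "c \<odot>\<^bsub>direct_sum I M\<^esub> e = (\<lambda>i\<in>I. c \<odot>\<^bsub>M i\<^esub> e i)"
  by (simp_all add: direct_sum_def)

lemma direct_sum_carrier_iff:
  "e \<in> carrier (direct_sum I M) \<longleftrightarrow> e \<in> extensional I \<and> (\<forall>i\<in>I. e i \<in> carrier (M i)) \<and>
     finite {i \<in> I. e i \<noteq> \<zero>\<^bsub>M i\<^esub>}"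
  by (auto simp: direct_sum_def PiE_def Pi_def)

text \<open>The laws hold in every component. What remains is finiteness of supports: a sum can be
  nonzero only where a summand is, and a multiple or a negative only where the element itself
  is.\<close>

lemma module_direct_sum:
  assumes "cring C" and mod: "\<And>i. i \<in> I \<Longrightarrow> module C (M i)"
  shows "module C (direct_sum I M)"
proof (rule moduleI)
  let ?D = "direct_sum I M"
  note simps = direct_sum_simps direct_sum_carrier_iff
  have ab: "abelian_group (M i)" if "i \<in> I" for i
    using mod[OF that] by (simp add: module_def)
  have add: "(\<lambda>i\<in>I. e i \<oplus>\<^bsub>M i\<^esub> f i) \<in> carrier ?D" if "e \<in> carrier ?D" "f \<in> carrier ?D" for e f
  proof -
    have "{i \<in> I. e i \<oplus>\<^bsub>M i\<^esub> f i \<noteq> \<zero>\<^bsub>M i\<^esub>} \<subseteq> {i \<in> I. e i \<noteq> \<zero>\<^bsub>M i\<^esub>} \<union> {i \<in> I. f i \<noteq> \<zero>\<^bsub>M i\<^esub>}"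
      using ab by (auto simp: abelian_group_def abelian_monoid.l_zero abelian_monoid.zero_closed)
    from finite_subset[OF this] that show ?thesis
      using ab by (auto simp: simps abelian_group_def abelian_monoid.a_closed cong: conj_cong)
  qed
  have smult: "(\<lambda>i\<in>I. c \<odot>\<^bsub>M i\<^esub> e i) \<in> carrier ?D" if "c \<in> carrier C" "e \<in> carrier ?D" for c e
  proof -
    have "{i \<in> I. c \<odot>\<^bsub>M i\<^esub> e i \<noteq> \<zero>\<^bsub>M i\<^esub>} \<subseteq> {i \<in> I. e i \<noteq> \<zero>\<^bsub>M i\<^esub>}"
      using module.smult_r_null[OF mod that(1)] by auto
    from finite_subset[OF this] that show ?thesis
      using module.smult_closed[OF mod that(1)] by (auto simp: simps cong: conj_cong)
  qed
  have neg: "(\<lambda>i\<in>I. \<ominus>\<^bsub>M i\<^esub> e i) \<in> carrier ?D" if "e \<in> carrier ?D" for e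
  proof -
    have "\<ominus>\<^bsub>M i\<^esub> \<zero>\<^bsub>M i\<^esub> = \<zero>\<^bsub>M i\<^esub>" if "i \<in> I" for i
    proof -
      interpret abelian_group "M i" using ab[OF that] .
      show ?thesis by (rule minus_equality) simp_all
    qed
    then have "{i \<in> I. \<ominus>\<^bsub>M i\<^esub> e i \<noteq> \<zero>\<^bsub>M i\<^esub>} \<subseteq> {i \<in> I. e i \<noteq> \<zero>\<^bsub>M i\<^esub>}"
      by auto
    from finite_subset[OF this] that show ?thesis
      using ab by (auto simp: simps abelian_group.a_inv_closed cong: conj_cong)
  qed
  show "abelian_group ?D"
  proof (rule abelian_groupI)
    show "\<exists>f\<in>carrier ?D. f \<oplus>\<^bsub>?D\<^esub> e = \<zero>\<^bsub>?D\<^esub>" if e: "e \<in> carrier ?D" for e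
      using neg[OF e] e ab
      by (intro bexI[of _ "\<lambda>i\<in>I. \<ominus>\<^bsub>M i\<^esub> e i"])
        (auto simp: simps abelian_group.l_neg intro!: restrict_ext)
    show "\<zero>\<^bsub>?D\<^esub> \<in> carrier ?D"
      using ab by (auto simp: simps abelian_group_def abelian_monoid.zero_closed cong: conj_cong)
    show "\<zero>\<^bsub>?D\<^esub> \<oplus>\<^bsub>?D\<^esub> e = e" if e: "e \<in> carrier ?D" for e
      using e ab
      by (auto simp: simps abelian_group_def abelian_monoid.l_zero fun_eq_iff extensional_def)
  qed (use add ab in \<open>auto simp: simps abelian_group_def abelian_monoid.a_comm abelian_monoid.a_assoc
      intro!: restrict_ext\<close>)
  show "\<one>\<^bsub>C\<^esub> \<odot>\<^bsub>?D\<^esub> e = e" if e: "e \<in> carrier ?D" for e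
    using e mod by (auto simp: simps module.smult_one fun_eq_iff extensional_def)
  show "c \<odot>\<^bsub>?D\<^esub> e \<in> carrier ?D" if "c \<in> carrier C" "e \<in> carrier ?D" for c e
    using smult[OF that] by (simp add: direct_sum_simps)
  show "(a \<oplus>\<^bsub>C\<^esub> b) \<odot>\<^bsub>?D\<^esub> e = a \<odot>\<^bsub>?D\<^esub> e \<oplus>\<^bsub>?D\<^esub> b \<odot>\<^bsub>?D\<^esub> e"
    if "a \<in> carrier C" "b \<in> carrier C" "e \<in> carrier ?D" for a b e
    using that module.smult_l_distr[OF mod, of _ a b "e _"]
    by (auto simp: direct_sum_simps direct_sum_carrier_iff intro!: restrict_ext)
  show "a \<odot>\<^bsub>?D\<^esub> (e \<oplus>\<^bsub>?D\<^esub> f) = a \<odot>\<^bsub>?D\<^esub> e \<oplus>\<^bsub>?D\<^esub> a \<odot>\<^bsub>?D\<^esub> f"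
    if "a \<in> carrier C" "e \<in> carrier ?D" "f \<in> carrier ?D" for a e f
    using that module.smult_r_distr[OF mod, of _ a "e _" "f _"]
    by (auto simp: direct_sum_simps direct_sum_carrier_iff intro!: restrict_ext)
  show "a \<otimes>\<^bsub>C\<^esub> b \<odot>\<^bsub>?D\<^esub> e = a \<odot>\<^bsub>?D\<^esub> (b \<odot>\<^bsub>?D\<^esub> e)"
    if "a \<in> carrier C" "b \<in> carrier C" "e \<in> carrier ?D" for a b e
    using that module.smult_assoc1[OF mod, of _ a b "e _"]
    by (auto simp: direct_sum_simps direct_sum_carrier_iff intro!: restrict_ext)
qed (rule assms(1))


section \<open>The free algebra\<close>

text \<open>The product of \<open>free_algebra\<close>, detached from its carrier. Its identities
  are proved for arbitrary coefficient functions, with no condition on supports, so that shifted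
  functions such as \<open>\<lambda>u. f (x # u)\<close> are covered too.\<close>

definition word_conv :: "('c, 'b) ring_scheme \<Rightarrow> ('x list \<Rightarrow> 'c) \<Rightarrow> ('x list \<Rightarrow> 'c) \<Rightarrow> 'x list \<Rightarrow> 'c" where
  "word_conv C f g w = (\<Oplus>\<^bsub>C\<^esub>k\<in>{..length w}. f (take k w) \<otimes>\<^bsub>C\<^esub> g (drop k w))"

text \<open>The coefficient \<open>c\<close> times the word \<open>u\<close>. It subsumes
  \<open>free_const\<close>, where the word is empty, and \<open>free_gen\<close>, where it is a
  single letter with coefficient 1.\<close>

definition word_monom :: "('c, 'b) ring_scheme \<Rightarrow> 'c \<Rightarrow> 'x list \<Rightarrow> 'x list \<Rightarrow> 'c" where
  "word_monom C c u = (\<lambda>w. if w = u then c else \<zero>\<^bsub>C\<^esub>)"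

context cring
begin

lemma word_conv_closed:
  "range f \<subseteq> carrier R \<Longrightarrow> range g \<subseteq> carrier R \<Longrightarrow> word_conv R f g w \<in> carrier R"
  unfolding word_conv_def by (intro finsum_closed) (auto simp: image_subset_iff)

lemma word_conv_Nil [simp]:
  "range f \<subseteq> carrier R \<Longrightarrow> range g \<subseteq> carrier R \<Longrightarrow> word_conv R f g [] = f [] \<otimes> g []"
  by (simp add: word_conv_def image_subset_iff)

text \<open>Splitting off the first letter turns associativity into an induction on the word.\<close>

lemma word_conv_Cons:
  assumes "range f \<subseteq> carrier R" "range g \<subseteq> carrier R"
  shows "word_conv R f g (x # w) = f [] \<otimes> g (x # w) \<oplus> word_conv R (\<lambda>u. f (x # u)) g w"
  using assms unfolding word_conv_def
  by (simp only: list.size add_0_right add_Suc_right, subst finsum_Suc2)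
    (auto simp: image_subset_iff intro!: a_comm finsum_closed)

lemma word_conv_add_left:
  assumes "range f \<subseteq> carrier R" "range f' \<subseteq> carrier R" "range g \<subseteq> carrier R"
  shows "word_conv R (\<lambda>u. f u \<oplus> f' u) g w = word_conv R f g w \<oplus> word_conv R f' g w"
  using assms by (induction w arbitrary: f f')
    (auto simp: word_conv_Cons word_conv_closed image_subset_iff l_distr a_ac)

lemma word_conv_add_right:
  assumes "range f \<subseteq> carrier R" "range g \<subseteq> carrier R" "range g' \<subseteq> carrier R"
  shows "word_conv R f (\<lambda>u. g u \<oplus> g' u) w = word_conv R f g w \<oplus> word_conv R f g' w"
  using assms by (induction w arbitrary: f)
    (auto simp: word_conv_Cons word_conv_closed image_subset_iff r_distr a_ac)

lemma word_conv_smult_left: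
  assumes "range f \<subseteq> carrier R" "range g \<subseteq> carrier R" "c \<in> carrier R"
  shows "word_conv R (\<lambda>u. c \<otimes> f u) g w = c \<otimes> word_conv R f g w"
  using assms by (induction w arbitrary: f)
    (auto simp: word_conv_Cons word_conv_closed image_subset_iff r_distr m_assoc)

lemma word_conv_zero_left:
  "range g \<subseteq> carrier R \<Longrightarrow> word_conv R (\<lambda>u. \<zero>) g w = \<zero>"
  by (induction w) (auto simp: word_conv_Cons image_subset_iff)

lemma word_conv_assoc:
  assumes "range f \<subseteq> carrier R" "range g \<subseteq> carrier R" "range h \<subseteq> carrier R"
  shows "word_conv R (word_conv R f g) h w = word_conv R f (word_conv R g h) w"
  using assms
proof (induction w arbitrary: f)
  case Nil
  then show ?case
    by (simp add: word_conv_closed image_subset_iff m_assoc)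
next
  case (Cons x w)
  have *: "range (\<lambda>u. f (x # u)) \<subseteq> carrier R" "range (\<lambda>u. g (x # u)) \<subseteq> carrier R"
    "range (word_conv R f g) \<subseteq> carrier R" "range (word_conv R g h) \<subseteq> carrier R"
    "f u \<in> carrier R" "g u \<in> carrier R" "h u \<in> carrier R" for u
    using Cons.prems by (auto intro!: word_conv_closed)
  have "word_conv R (word_conv R f g) h (x # w)
     = f [] \<otimes> g [] \<otimes> h (x # w) \<oplus> word_conv R (\<lambda>u. f [] \<otimes> g (x # u) \<oplus> word_conv R (\<lambda>u. f (x # u)) g u) h w"
    using Cons.prems * by (simp add: word_conv_Cons[where f = "word_conv R f g"] word_conv_Cons[of f g])
  \<comment> \<open>Removing the first letter from f * g leaves a multiple of the shifted g plus the
    shifted f times g. The second term falls under the induction hypothesis for the shifted f, which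
    is why \<open>f\<close> is generalized.\<close>
  also have "word_conv R (\<lambda>u. f [] \<otimes> g (x # u) \<oplus> word_conv R (\<lambda>u. f (x # u)) g u) h w
     = f [] \<otimes> word_conv R (\<lambda>u. g (x # u)) h w \<oplus> word_conv R (word_conv R (\<lambda>u. f (x # u)) g) h w"
    using Cons.prems *
    by (subst word_conv_add_left) (auto simp: word_conv_smult_left intro!: word_conv_closed)
  also have "word_conv R (word_conv R (\<lambda>u. f (x # u)) g) h w = word_conv R (\<lambda>u. f (x # u)) (word_conv R g h) w"
    using Cons.prems * by (intro Cons.IH) auto
  finally show ?case
    using Cons.prems *
    by (simp add: word_conv_Cons word_conv_closed m_assoc r_distr a_assoc)
qed

lemma word_conv_monom:
  assumes "c \<in> carrier R" "range g \<subseteq> carrier R"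
  shows "word_conv R (word_monom R c u) g (u @ w) = c \<otimes> g w"
  using assms
proof (induction u)
  case Nil
  have "(\<lambda>u. if x # u = [] then c else \<zero>) = (\<lambda>u. \<zero>)" for x :: 'b by auto
  with Nil show ?case
    by (cases w) (auto simp: word_conv_Cons word_conv_zero_left word_monom_def image_subset_iff)
next
  case (Cons x u)
  have "(\<lambda>ua. word_monom R c (x # u) (x # ua)) = word_monom R c u"
    by (auto simp: word_monom_def)
  with Cons show ?case
    by (auto simp: word_conv_Cons word_monom_def image_subset_iff word_conv_closed)
qed

text \<open>With \<open>word_conv_monom\<close> this determines all coefficients of a product whose
  left factor is a monomial.\<close>

lemma word_conv_monom_other:
  assumes "c \<in> carrier R" "range g \<subseteq> carrier R" "\<And>v. w \<noteq> u @ v"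
  shows "word_conv R (word_monom R c u) g w = \<zero>"
  using assms
proof (induction u arbitrary: w)
  case (Cons x u)
  have e: "(\<lambda>ua. word_monom R c (x # u) (x # ua)) = word_monom R c u"
    by (auto simp: word_monom_def)
  have e': "(\<lambda>ua. word_monom R c (x # u) (y # ua)) = (\<lambda>_. \<zero>)" if "y \<noteq> x" for y
    using that by (auto simp: word_monom_def)
  have n: "word_monom R c (x # u) [] = \<zero>"
    by (simp add: word_monom_def)
  have r: "range (word_monom R c (x # u)) \<subseteq> carrier R"
    using Cons.prems by (auto simp: word_monom_def)
  show ?case
  proof (cases w)
    case Nil
    with Cons.prems show ?thesis
      by (simp add: word_monom_def image_subset_iff)
  next
    case w: (Cons y w')
    have "g w \<in> carrier R"
      using Cons.prems by auto
    with w Cons.prems Cons.IH[of w'] show ?thesis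
      by (cases "y = x")
        (auto simp: word_conv_Cons[OF r Cons.prems(2)] e e' word_conv_zero_left n)
  qed
qed auto

lemma word_conv_monom_Nil_right:
  assumes "range f \<subseteq> carrier R" "c \<in> carrier R"
  shows "word_conv R f (word_monom R c []) w = f w \<otimes> c"
  using assms
proof (induction w arbitrary: f)
  case (Cons x w)
  have r: "range (word_monom R c []) \<subseteq> carrier R"
    using Cons.prems by (auto simp: word_monom_def)
  moreover have "word_conv R (\<lambda>u. f (x # u)) (word_monom R c []) w = f (x # w) \<otimes> c"
    using Cons.prems by (intro Cons.IH) auto
  ultimately show ?case
    using Cons.prems word_conv_Cons[OF Cons.prems(1) r, of x w]
    by (simp add: image_subset_iff) (simp add: word_monom_def)
qed (subst word_conv_Nil, auto simp: word_monom_def)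

text \<open>Confines the support of a product to concatenations of words from the two supports; both
  finiteness and the restriction to letters from \<open>X\<close> follow.\<close>

lemma word_conv_support:
  assumes "range f \<subseteq> carrier R" "range g \<subseteq> carrier R" "word_conv R f g w \<noteq> \<zero>"
  obtains u v where "w = u @ v" "f u \<noteq> \<zero>" "g v \<noteq> \<zero>"
proof -
  have "\<exists>k. f (take k w) \<noteq> \<zero> \<and> g (drop k w) \<noteq> \<zero>"
  proof (rule ccontr)
    assume "\<not> ?thesis"
    then have "f (take k w) \<otimes> g (drop k w) = \<zero>" for k
      using assms(1,2) by (metis image_subset_iff iso_tuple_UNIV_I l_null r_null)
    then show False
      using assms(3) by (simp add: word_conv_def)
  qed
  then show ?thesis
    using that by (metis append_take_drop_id)
qed

end

lemma free_algebra_carrier_iff: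
  "f \<in> carrier (free_algebra C X) \<longleftrightarrow>
     range f \<subseteq> carrier C \<and> finite {w. f w \<noteq> \<zero>\<^bsub>C\<^esub>} \<and> {w. f w \<noteq> \<zero>\<^bsub>C\<^esub>} \<subseteq> lists X"
  by (auto simp: free_algebra_def)

lemma free_algebra_ops:
  "f \<otimes>\<^bsub>free_algebra C X\<^esub> g = word_conv C f g"
  "f \<oplus>\<^bsub>free_algebra C X\<^esub> g = (\<lambda>w. f w \<oplus>\<^bsub>C\<^esub> g w)"
  "\<zero>\<^bsub>free_algebra C X\<^esub> = (\<lambda>w. \<zero>\<^bsub>C\<^esub>)"
  "\<one>\<^bsub>free_algebra C X\<^esub> = word_monom C \<one>\<^bsub>C\<^esub> []"
  by (auto simp: free_algebra_def word_conv_def word_monom_def)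

lemma free_const_eq_monom: "free_const C c = word_monom C c []"
  by (simp add: free_const_def word_monom_def)

lemma free_gen_eq_monom: "free_gen C x = word_monom C \<one>\<^bsub>C\<^esub> [x]"
  by (simp add: free_gen_def word_monom_def)

context cring
begin

lemma word_monom_carrier:
  "c \<in> carrier R \<Longrightarrow> u \<in> lists X \<Longrightarrow> word_monom R c u \<in> carrier (free_algebra R X)"
  by (auto simp: free_algebra_carrier_iff word_monom_def)

lemma free_algebra_add_closed:
  assumes "f \<in> carrier (free_algebra R X)" "g \<in> carrier (free_algebra R X)"
  shows "(\<lambda>w. f w \<oplus> g w) \<in> carrier (free_algebra R X)"
proof -
  have "{w. f w \<oplus> g w \<noteq> \<zero>} \<subseteq> {w. f w \<noteq> \<zero>} \<union> {w. g w \<noteq> \<zero>}" by auto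
  with assms show ?thesis
    unfolding free_algebra_carrier_iff
    using finite_subset[of "{w. f w \<oplus> g w \<noteq> \<zero>}"] by (intro conjI) (blast+)
qed

lemma free_algebra_conv_closed:
  assumes "f \<in> carrier (free_algebra R X)" "g \<in> carrier (free_algebra R X)"
  shows "word_conv R f g \<in> carrier (free_algebra R X)"
proof -
  have r: "range f \<subseteq> carrier R" "range g \<subseteq> carrier R"
    using assms by (auto simp: free_algebra_carrier_iff)
  have sub: "{w. word_conv R f g w \<noteq> \<zero>} \<subseteq> (\<lambda>(u, v). u @ v) ` ({w. f w \<noteq> \<zero>} \<times> {w. g w \<noteq> \<zero>})"
    by (auto elim!: word_conv_support[OF r])
  have "finite {w. word_conv R f g w \<noteq> \<zero>}"
    by (rule finite_subset[OF sub]) (use assms in \<open>auto simp: free_algebra_carrier_iff\<close>)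
  moreover have "{w. word_conv R f g w \<noteq> \<zero>} \<subseteq> lists X"
  proof
    fix w assume "w \<in> {w. word_conv R f g w \<noteq> \<zero>}"
    then obtain u v where "w = u @ v" "f u \<noteq> \<zero>" "g v \<noteq> \<zero>"
      using word_conv_support[OF r] by blast
    moreover from this have "u \<in> lists X" "v \<in> lists X"
      using assms unfolding free_algebra_carrier_iff by blast+
    ultimately show "w \<in> lists X" by simp
  qed
  ultimately show ?thesis
    using r by (auto simp: free_algebra_carrier_iff intro!: word_conv_closed)
qed

lemma free_algebra_ring: "ring (free_algebra R X)"
proof (rule ringI)
  have car: "f w \<in> carrier R" if "f \<in> carrier (free_algebra R X)" for f w
    using that by (auto simp: free_algebra_carrier_iff)
  have ran: "range f \<subseteq> carrier R" if "f \<in> carrier (free_algebra R X)" for f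
    using that by (auto simp: free_algebra_carrier_iff)
  show "abelian_group (free_algebra R X)"
  proof (rule abelian_groupI)
    show "\<exists>g\<in>carrier (free_algebra R X). g \<oplus>\<^bsub>free_algebra R X\<^esub> f = \<zero>\<^bsub>free_algebra R X\<^esub>"
      if f: "f \<in> carrier (free_algebra R X)" for f
    proof (rule bexI)
      have "{w. \<ominus> f w \<noteq> \<zero>} \<subseteq> {w. f w \<noteq> \<zero>}" by auto
      then show "(\<lambda>w. \<ominus> f w) \<in> carrier (free_algebra R X)"
        using f unfolding free_algebra_carrier_iff
        by (intro conjI; (rule finite_subset)?) (auto simp: image_subset_iff)
    qed (use car[OF f] in \<open>simp add: free_algebra_ops l_neg\<close>)
  qed (simp_all add: free_algebra_ops free_algebra_add_closed,
      auto simp: free_algebra_carrier_iff image_subset_iff a_ac)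
  show "Group.monoid (free_algebra R X)"
  proof (rule monoidI)
    show "\<one>\<^bsub>free_algebra R X\<^esub> \<in> carrier (free_algebra R X)"
      by (simp add: free_algebra_ops word_monom_carrier)
    show "\<one>\<^bsub>free_algebra R X\<^esub> \<otimes>\<^bsub>free_algebra R X\<^esub> f = f" if "f \<in> carrier (free_algebra R X)" for f
      using word_conv_monom[OF one_closed ran[OF that], of "[]"] car[OF that]
      by (simp add: free_algebra_ops fun_eq_iff)
    show "f \<otimes>\<^bsub>free_algebra R X\<^esub> \<one>\<^bsub>free_algebra R X\<^esub> = f" if "f \<in> carrier (free_algebra R X)" for f
      using word_conv_monom_Nil_right[OF ran[OF that] one_closed] car[OF that]
      by (simp add: free_algebra_ops fun_eq_iff)
  qed (auto simp: free_algebra_ops free_algebra_conv_closed word_conv_assoc ran fun_eq_iff)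
qed (auto simp: free_algebra_ops fun_eq_iff word_conv_add_left word_conv_add_right free_algebra_carrier_iff)

lemma free_algebra_monom_mult:
  assumes "c \<in> carrier R" "d \<in> carrier R"
  shows "word_conv R (word_monom R c u) (word_monom R d v) = word_monom R (c \<otimes> d) (u @ v)"
proof
  fix w
  have r: "range (word_monom R d v) \<subseteq> carrier R"
    using assms by (auto simp: word_monom_def)
  show "word_conv R (word_monom R c u) (word_monom R d v) w = word_monom R (c \<otimes> d) (u @ v) w"
  proof (cases "\<exists>w'. w = u @ w'")
    case True
    then obtain w' where "w = u @ w'" by blast
    then show ?thesis
      using word_conv_monom[OF assms(1) r, of u w'] assms(1) by (simp add: word_monom_def)
  next
    case False
    then show ?thesis
      using word_conv_monom_other[OF assms(1) r, of w u] by (auto simp: word_monom_def)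
  qed
qed

text \<open>An element is the finite sum of its monomials. The induction runs over the support and
  removes a word by setting its coefficient to zero.\<close>

lemma free_algebra_induct [consumes 1, case_names zero add]:
  assumes "f \<in> carrier (free_algebra R X)"
    and zero: "P (\<lambda>w. \<zero>)"
    and add: "\<And>c u f. c \<in> carrier R \<Longrightarrow> u \<in> lists X \<Longrightarrow> f \<in> carrier (free_algebra R X) \<Longrightarrow> P f
      \<Longrightarrow> P (word_monom R c u \<oplus>\<^bsub>free_algebra R X\<^esub> f)"
  shows "P f"
proof -
  have "finite {w. f w \<noteq> \<zero>}" "{w. f w \<noteq> \<zero>} \<subseteq> lists X"
    using assms(1) by (auto simp: free_algebra_carrier_iff)
  then show ?thesis
    using assms(1)
  proof (induction "{w. f w \<noteq> \<zero>}" arbitrary: f rule: finite_induct)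
    case empty
    then have "f = (\<lambda>w. \<zero>)" by auto
    then show ?case using zero by simp
  next
    case (insert u S)
    define f' where "f' = f(u := \<zero>)"
    have S: "S = {w. f' w \<noteq> \<zero>}"
      using insert.hyps(2,4) by (auto simp: f'_def)
    have f': "f' \<in> carrier (free_algebra R X)"
      unfolding free_algebra_carrier_iff S[symmetric]
      using insert.hyps(1,4) insert.prems by (auto simp: f'_def free_algebra_carrier_iff image_subset_iff)
    have "P (word_monom R (f u) u \<oplus>\<^bsub>free_algebra R X\<^esub> f')"
    proof (rule add)
      show "P f'"
        using f' S insert.hyps(3)[of f'] by (simp add: free_algebra_carrier_iff)
    qed (use insert f' in \<open>auto simp: free_algebra_carrier_iff\<close>)
    also have "word_monom R (f u) u \<oplus>\<^bsub>free_algebra R X\<^esub> f' = f"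
      using insert.prems by (auto simp: free_algebra_ops word_monom_def f'_def fun_eq_iff
          free_algebra_carrier_iff image_subset_iff)
    finally show ?case .
  qed
qed

end

section \<open>Homomorphisms from the free algebra, given on coefficients and letters\<close>

text \<open>Nested to the right with a final unit, the shape of the products in
  \<open>weight_monomials\<close>.\<close>

definition word_prod :: "('r, 'b) ring_scheme \<Rightarrow> ('x \<Rightarrow> 'r) \<Rightarrow> 'x list \<Rightarrow> 'r" where
  "word_prod S g w = foldr (\<lambda>x a. g x \<otimes>\<^bsub>S\<^esub> a) w \<one>\<^bsub>S\<^esub>"

context ring
begin

lemma word_prod_simps [simp]:
  "word_prod R g [] = \<one>" "word_prod R g (x # w) = g x \<otimes> word_prod R g w"
  by (simp_all add: word_prod_def)

lemma word_prod_closed: "g ` set w \<subseteq> carrier R \<Longrightarrow> word_prod R g w \<in> carrier R"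
  by (induction w) auto

lemma word_prod_append:
  "g ` set u \<subseteq> carrier R \<Longrightarrow> g ` set v \<subseteq> carrier R \<Longrightarrow>
    word_prod R g (u @ v) = word_prod R g u \<otimes> word_prod R g v"
  by (induction u) (auto simp: word_prod_closed m_assoc)

lemma word_prod_commute:
  assumes "c \<in> carrier R" "g ` set w \<subseteq> carrier R" "\<And>x. x \<in> set w \<Longrightarrow> c \<otimes> g x = g x \<otimes> c"
  shows "c \<otimes> word_prod R g w = word_prod R g w \<otimes> c"
  using assms
proof (induction w)
  case (Cons x w)
  then have "c \<otimes> word_prod R g w = word_prod R g w \<otimes> c" "c \<otimes> g x = g x \<otimes> c"
    "word_prod R g w \<in> carrier R" "g x \<in> carrier R"
    by (auto simp: word_prod_closed)
  then show ?case
    using Cons.prems(1) by (metis m_assoc word_prod_simps(2))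
qed simp

end

text \<open>In the free algebra coefficients commute with letters, whereas \<open>S\<close> may be
  noncommutative. Hypothesis \<open>comm\<close> allows the coefficient of a second monomial to pass
  the letters of the first, which gives multiplicativity on monomials;
  \<open>free_algebra_induct\<close> extends it in one factor after the other.\<close>

lemma free_algebra_universal:
  fixes C (structure) and S
  assumes "cring C" "ring S"
    and \<gamma>: "\<gamma> \<in> ring_hom C S"
    and g: "g \<in> X \<rightarrow> carrier S"
    and comm: "\<And>c x. c \<in> carrier C \<Longrightarrow> x \<in> X \<Longrightarrow> \<gamma> c \<otimes>\<^bsub>S\<^esub> g x = g x \<otimes>\<^bsub>S\<^esub> \<gamma> c"
  obtains h where "h \<in> ring_hom (free_algebra C X) S"
    "\<And>c w. c \<in> carrier C \<Longrightarrow> w \<in> lists X \<Longrightarrow> h (word_monom C c w) = \<gamma> c \<otimes>\<^bsub>S\<^esub> word_prod S g w"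
proof -
  interpret C: cring C by fact
  interpret S: ring S by fact
  interpret F: ring "free_algebra C X" by (rule C.free_algebra_ring)
  interpret \<gamma>: ring_hom_ring C S \<gamma>
    using \<gamma> by (intro ring_hom_ringI2) (auto intro: C.ring_axioms S.ring_axioms)
  let ?t = "\<lambda>f w. \<gamma> (f w) \<otimes>\<^bsub>S\<^esub> word_prod S g w"
  define h where "h f = (\<Oplus>\<^bsub>S\<^esub>w\<in>{w. f w \<noteq> \<zero>}. ?t f w)" for f
  have wp: "word_prod S g w \<in> carrier S" if "w \<in> lists X" for w
    using that g by (intro S.word_prod_closed) auto
  \<comment> \<open>Summation over any finite set of words containing the support, so that
    \<open>f\<close>, \<open>f'\<close> and their sum can share one index set.\<close>
  have h_eq: "h f = (\<Oplus>\<^bsub>S\<^esub>w\<in>A. ?t f w)"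
    if "f \<in> carrier (free_algebra C X)" "finite A" "{w. f w \<noteq> \<zero>} \<subseteq> A" "A \<subseteq> lists X" for f A
    unfolding h_def
    by (rule S.add.finprod_mono_neutral_cong_left)
      (use that wp in \<open>auto simp: free_algebra_carrier_iff image_subset_iff subset_iff\<close>)
  have closed: "h f \<in> carrier S" if "f \<in> carrier (free_algebra C X)" for f
    unfolding h_def
    by (rule S.finsum_closed) (use that wp in \<open>auto simp: free_algebra_carrier_iff image_subset_iff subset_iff\<close>)
  have h_add: "h (f \<oplus>\<^bsub>free_algebra C X\<^esub> f') = h f \<oplus>\<^bsub>S\<^esub> h f'"
    if f: "f \<in> carrier (free_algebra C X)" and f': "f' \<in> carrier (free_algebra C X)" for f f'
  proof -
    let ?A = "{w. f w \<noteq> \<zero>} \<union> {w. f' w \<noteq> \<zero>}"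
    have A: "finite ?A" "?A \<subseteq> lists X"
      using f f' by (auto simp: free_algebra_carrier_iff)
    have "h (f \<oplus>\<^bsub>free_algebra C X\<^esub> f') = (\<Oplus>\<^bsub>S\<^esub>w\<in>?A. ?t (f \<oplus>\<^bsub>free_algebra C X\<^esub> f') w)"
      by (rule h_eq[OF F.a_closed[OF f f'] A(1) _ A(2)]) (auto simp: free_algebra_ops)
    also have "\<dots> = (\<Oplus>\<^bsub>S\<^esub>w\<in>?A. ?t f w \<oplus>\<^bsub>S\<^esub> ?t f' w)"
      by (rule S.finsum_cong')
        (use f f' A(2) wp in \<open>auto simp: free_algebra_ops free_algebra_carrier_iff image_subset_iff
          S.l_distr subset_iff\<close>)
    also have "\<dots> = h f \<oplus>\<^bsub>S\<^esub> h f'"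
      using f f' A wp
      by (subst S.finsum_addf)
        (auto simp: h_eq[OF f A(1) _ A(2)] h_eq[OF f' A(1) _ A(2)] free_algebra_carrier_iff
          image_subset_iff subset_iff)
    finally show ?thesis .
  qed
  have monom: "h (word_monom C c w) = \<gamma> c \<otimes>\<^bsub>S\<^esub> word_prod S g w" if "c \<in> carrier C" "w \<in> lists X" for c w
  proof -
    have "h (word_monom C c w) = (\<Oplus>\<^bsub>S\<^esub>v\<in>{w}. ?t (word_monom C c w) v)"
      by (rule h_eq[OF C.word_monom_carrier[OF that]]) (use that in \<open>auto simp: word_monom_def\<close>)
    then show ?thesis
      using that wp by (simp add: word_monom_def)
  qed
  have h_zero: "h (\<lambda>w. \<zero>) = \<zero>\<^bsub>S\<^esub>"
    by (simp add: h_def)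
  have mult_monom: "h (word_monom C c u \<otimes>\<^bsub>free_algebra C X\<^esub> word_monom C d v)
      = h (word_monom C c u) \<otimes>\<^bsub>S\<^esub> h (word_monom C d v)"
    if "c \<in> carrier C" "d \<in> carrier C" "u \<in> lists X" "v \<in> lists X" for c d u v
  proof -
    have gs: "g ` set u \<subseteq> carrier S" "g ` set v \<subseteq> carrier S"
      using that g by auto
    have "\<gamma> d \<otimes>\<^bsub>S\<^esub> word_prod S g u = word_prod S g u \<otimes>\<^bsub>S\<^esub> \<gamma> d"
      by (rule S.word_prod_commute) (use that comm gs in auto)
    then have "\<gamma> c \<otimes>\<^bsub>S\<^esub> \<gamma> d \<otimes>\<^bsub>S\<^esub> (word_prod S g u \<otimes>\<^bsub>S\<^esub> word_prod S g v)
       = \<gamma> c \<otimes>\<^bsub>S\<^esub> word_prod S g u \<otimes>\<^bsub>S\<^esub> (\<gamma> d \<otimes>\<^bsub>S\<^esub> word_prod S g v)"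
      using that wp by (simp add: S.m_assoc) (simp add: S.m_assoc[symmetric])
    then show ?thesis
      using that gs by (simp add: free_algebra_ops C.free_algebra_monom_mult monom S.word_prod_append)
  qed
  have mult1: "h (word_monom C c u \<otimes>\<^bsub>free_algebra C X\<^esub> f) = h (word_monom C c u) \<otimes>\<^bsub>S\<^esub> h f"
    if c: "c \<in> carrier C" and u: "u \<in> lists X" and f: "f \<in> carrier (free_algebra C X)" for c u f
    using f
  proof (induction rule: C.free_algebra_induct)
    case zero
    show ?case
      using F.r_null[OF C.word_monom_carrier[OF c u]] closed[OF C.word_monom_carrier[OF c u]] h_zero
      by (simp add: free_algebra_ops)
  next
    case (add d v f)
    then show ?case
      using c u by (simp add: F.r_distr C.word_monom_carrier h_add
          mult_monom closed S.r_distr)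
  qed
  have mult: "h (f \<otimes>\<^bsub>free_algebra C X\<^esub> f') = h f \<otimes>\<^bsub>S\<^esub> h f'"
    if f: "f \<in> carrier (free_algebra C X)" and f': "f' \<in> carrier (free_algebra C X)" for f f'
    using f
  proof (induction rule: C.free_algebra_induct)
    case zero
    show ?case
      using F.l_null[OF f'] closed[OF f'] h_zero by (simp add: free_algebra_ops)
  next
    case (add d v f)
    then show ?case
      using f' by (simp add: F.l_distr C.word_monom_carrier h_add
          mult1 closed S.l_distr)
  qed
  have "h \<in> ring_hom (free_algebra C X) S"
    by (rule ring_hom_memI)
      (use closed h_add mult monom[of \<one> "[]"] in \<open>auto simp: free_algebra_ops\<close>)
  then show thesis
    using monom that by blast
qed


section \<open>Universal property of the graded symmetric algebra\<close>

text \<open>The kernel of \<open>h\<close> is an ideal containing \<open>X\<close>, hence contains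
  the ideal generated by \<open>X\<close>.\<close>

lemma quotient_genideal_universal:
  fixes R (structure) and S
  assumes "ring R" "ring S" and h: "h \<in> ring_hom R S"
    and X: "X \<subseteq> carrier R" "\<And>x. x \<in> X \<Longrightarrow> h x = \<zero>\<^bsub>S\<^esub>"
  obtains k where "k \<in> ring_hom (R Quot (Idl X)) S" "\<And>x. x \<in> carrier R \<Longrightarrow> k ((Idl X) +> x) = h x"
proof -
  interpret R: ring R by fact
  interpret S: ring S by fact
  interpret h: ring_hom_ring R S h
    using h by (intro ring_hom_ringI2) (auto intro: R.ring_axioms S.ring_axioms)
  interpret I: ideal "Idl X" R by (rule R.genideal_ideal[OF X(1)])
  have "Idl X \<subseteq> a_kernel R S h"
    using X unfolding a_kernel_def' by (intro R.genideal_minimal[OF h.kernel_is_ideal, unfolded a_kernel_def']) blast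
  then have ker: "h x = \<zero>\<^bsub>S\<^esub>" if "x \<in> Idl X" for x
    using that unfolding a_kernel_def' by blast
  \<comment> \<open>\<open>h\<close> is constant on cosets, so the image of a coset is a singleton
    and no representative has to be chosen.\<close>
  define k where "k Y = the_elem (h ` Y)" for Y
  have k: "k ((Idl X) +> x) = h x" if x: "x \<in> carrier R" for x
  proof -
    have "h y = h x" if "y \<in> (Idl X) +> x" for y
      using that x ker I.Icarr by (auto simp: a_r_coset_def')
    moreover have "x \<in> (Idl X) +> x"
      using I.a_rcos_self[OF x] .
    ultimately have "h ` ((Idl X) +> x) = {h x}" by blast
    then show ?thesis by (simp add: k_def)
  qed
  have rep: "\<exists>x\<in>carrier R. Y = (Idl X) +> x" if "Y \<in> carrier (R Quot (Idl X))" for Y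
    using that by (auto simp: FactRing_def A_RCOSETS_def')
  note p = I.rcos_ring_hom
  have "k \<in> ring_hom (R Quot (Idl X)) S"
  proof (rule ring_hom_memI)
    fix Y Z assume "Y \<in> carrier (R Quot (Idl X))" "Z \<in> carrier (R Quot (Idl X))"
    then obtain y z where yz: "y \<in> carrier R" "z \<in> carrier R" "Y = (Idl X) +> y" "Z = (Idl X) +> z"
      using rep by metis
    then show "k Y \<in> carrier S" by (simp add: k)
    show "k (Y \<otimes>\<^bsub>R Quot (Idl X)\<^esub> Z) = k Y \<otimes>\<^bsub>S\<^esub> k Z"
      using yz by (simp add: k ring_hom_mult[OF p, symmetric])
    show "k (Y \<oplus>\<^bsub>R Quot (Idl X)\<^esub> Z) = k Y \<oplus>\<^bsub>S\<^esub> k Z"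
      using yz by (simp add: k ring_hom_add[OF p, symmetric])
  next
    show "k \<one>\<^bsub>R Quot (Idl X)\<^esub> = \<one>\<^bsub>S\<^esub>"
      using k[OF R.one_closed] ring_hom_one[OF p] by simp
  qed
  then show thesis using k that by blast
qed

lemma (in ideal) quot_eqI:
  assumes "x \<in> carrier R" "y \<in> carrier R" "x \<ominus> y \<in> I"
  shows "I +> x = I +> y"
  using assms a_repr_independence[of x I y] a_rcos_module_minus[OF ring_axioms, of y x]
  by (simp add: is_additive_subgroup additive_subgroup.a_subgroup)

text \<open>The remainders modulo 2 are 0 or 1 also for negative weights, so the exponent is 1
  exactly when both weights are odd. This turns the Koszul sign into a case distinction.\<close>

lemma (in ring) sign_pow:
  fixes i j :: int
  assumes "x \<in> carrier R"
  shows "((\<ominus> \<one>) [^] nat ((i mod 2) * (j mod 2))) \<otimes> x = (if odd i \<and> odd j then \<ominus> x else x)"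
proof -
  have "nat ((i mod 2) * (j mod 2)) = (if odd i \<and> odd j then 1 else 0)"
    by (auto simp: odd_iff_mod_2_eq_one even_iff_mod_2_eq_zero)
  then show ?thesis
    using assms by (auto simp: l_minus)
qed

locale graded_space =
  fixes V :: "int \<Rightarrow> 'v::real_vector set"
  assumes V_subspace: "subspace (V i)"
begin

abbreviation "C \<equiv> coeff_ring V"
abbreviation "M \<equiv> gen_module V"
abbreviation "F \<equiv> free_algebra C (carrier M)"
abbreviation "T \<equiv> gen_tensor_algebra V"
abbreviation "A \<equiv> sym_algebra V"

sublocale C: cring C by (rule smooth_ring_cring[OF V_subspace])

lemma tensor_pair_V: "tensor_pair (V 0) (V i)"
  by (simp add: tensor_pair_def V_subspace)

sublocale M: module C M
  unfolding gen_module_def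
  by (rule module_direct_sum[OF C.is_cring tensor_pair.module_tensor_module[OF tensor_pair_V]])

sublocale F: ring F by (rule C.free_algebra_ring)

lemma free_const_closed: "c \<in> carrier C \<Longrightarrow> free_const C c \<in> carrier F"
  by (simp add: free_const_eq_monom C.word_monom_carrier)

lemma free_gen_closed: "m \<in> carrier M \<Longrightarrow> free_gen C m \<in> carrier F"
  by (simp add: free_gen_eq_monom C.word_monom_carrier)

definition tensor_rels :: "('v mod_elem list \<Rightarrow> 'v fn) set" where
  "tensor_rels = {free_gen C (m \<oplus>\<^bsub>M\<^esub> n) \<ominus>\<^bsub>F\<^esub> (free_gen C m \<oplus>\<^bsub>F\<^esub> free_gen C n) | m n.
            m \<in> carrier M \<and> n \<in> carrier M} \<union>
         {free_gen C (c \<odot>\<^bsub>M\<^esub> m) \<ominus>\<^bsub>F\<^esub> free_const C c \<otimes>\<^bsub>F\<^esub> free_gen C m | c m.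
            c \<in> carrier C \<and> m \<in> carrier M}"

lemma tensor_ideal_eq: "tensor_ideal C M = Idl\<^bsub>F\<^esub> tensor_rels"
  by (simp add: tensor_ideal_def tensor_rels_def Let_def)

lemma tensor_rels_closed: "tensor_rels \<subseteq> carrier F"
  by (auto simp: tensor_rels_def free_const_closed free_gen_closed)

sublocale I: ideal "tensor_ideal C M" F
  unfolding tensor_ideal_eq by (rule F.genideal_ideal[OF tensor_rels_closed])

lemma T_eq: "T = F Quot tensor_ideal C M"
  by (simp add: tensor_algebra_def)

sublocale T: ring T
  unfolding T_eq by (rule I.quotient_is_ring)

lemma gen_component_closed: "v \<in> gen_component V i \<Longrightarrow> v \<in> carrier M"
  by (simp add: gen_component_def)

lemma coset_hom_F: "(\<lambda>x. tensor_ideal C M +>\<^bsub>F\<^esub> x) \<in> ring_hom F T"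
  unfolding T_eq by (rule I.rcos_ring_hom)

lemma tensor_gen_closed: "m \<in> carrier M \<Longrightarrow> tensor_gen C M m \<in> carrier T"
  using ring_hom_closed[OF coset_hom_F free_gen_closed] by (simp add: tensor_gen_def)

definition sym_rels :: "'v tens set" where
  "sym_rels = {tensor_gen C M v \<otimes>\<^bsub>T\<^esub> tensor_gen C M w \<ominus>\<^bsub>T\<^esub>
              (if odd i \<and> odd j then \<ominus>\<^bsub>T\<^esub> (tensor_gen C M w \<otimes>\<^bsub>T\<^esub> tensor_gen C M v)
               else tensor_gen C M w \<otimes>\<^bsub>T\<^esub> tensor_gen C M v) | v w i j.
              i \<noteq> 0 \<and> j \<noteq> 0 \<and> v \<in> gen_component V i \<and> w \<in> gen_component V j}"

lemma symmetry_ideal_eq: "symmetry_ideal V = Idl\<^bsub>T\<^esub> sym_rels"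
proof -
  have "tensor_gen C M v \<otimes>\<^bsub>T\<^esub> tensor_gen C M w \<ominus>\<^bsub>T\<^esub>
              ((\<ominus>\<^bsub>T\<^esub> \<one>\<^bsub>T\<^esub>) [^]\<^bsub>T\<^esub> nat ((i mod 2) * (j mod 2))) \<otimes>\<^bsub>T\<^esub> (tensor_gen C M w \<otimes>\<^bsub>T\<^esub> tensor_gen C M v)
     = tensor_gen C M v \<otimes>\<^bsub>T\<^esub> tensor_gen C M w \<ominus>\<^bsub>T\<^esub>
              (if odd i \<and> odd j then \<ominus>\<^bsub>T\<^esub> (tensor_gen C M w \<otimes>\<^bsub>T\<^esub> tensor_gen C M v)
               else tensor_gen C M w \<otimes>\<^bsub>T\<^esub> tensor_gen C M v)"
    if "v \<in> gen_component V i" "w \<in> gen_component V j" for v w i j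
    by (subst T.sign_pow) (use that in \<open>simp_all add: tensor_gen_closed gen_component_closed\<close>)
  then show ?thesis
    unfolding symmetry_ideal_def sym_rels_def Let_def
    by (intro arg_cong[where f = "genideal T"] Collect_cong) metis
qed

lemma sym_rels_closed: "sym_rels \<subseteq> carrier T"
  by (auto simp: sym_rels_def tensor_gen_closed gen_component_closed)

sublocale J: ideal "symmetry_ideal V" T
  unfolding symmetry_ideal_eq by (rule T.genideal_ideal[OF sym_rels_closed])

sublocale A: ring A
  unfolding sym_algebra_def by (rule J.quotient_is_ring)

lemma coset_hom_T: "(\<lambda>x. symmetry_ideal V +>\<^bsub>T\<^esub> x) \<in> ring_hom T A"
  unfolding sym_algebra_def by (rule J.rcos_ring_hom)

text \<open>Passing through both quotients at once allows elements of \<open>A\<close> to be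
  represented by words, and identities of the free algebra to be transported directly.\<close>

definition proj :: "('v mod_elem list \<Rightarrow> 'v fn) \<Rightarrow> 'v tens set" where
  "proj x = symmetry_ideal V +>\<^bsub>T\<^esub> (tensor_ideal C M +>\<^bsub>F\<^esub> x)"

lemma proj_hom: "proj \<in> ring_hom F A"
  using ring_hom_trans[OF coset_hom_F coset_hom_T] by (simp add: proj_def[abs_def] comp_def)

lemma proj_surj: "carrier A = proj ` carrier F"
proof -
  have T: "carrier T = (\<lambda>x. tensor_ideal C M +>\<^bsub>F\<^esub> x) ` carrier F"
    unfolding T_eq by (auto simp: FactRing_def A_RCOSETS_def')
  have "carrier A = (\<lambda>x. symmetry_ideal V +>\<^bsub>T\<^esub> x) ` carrier T"
    by (auto simp: sym_algebra_def FactRing_def A_RCOSETS_def')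
  then show ?thesis
    by (auto simp: T proj_def[abs_def])
qed

lemma sym_const_eq: "sym_const V c = proj (word_monom C c [])"
  by (simp add: sym_const_def tensor_const_def proj_def free_const_eq_monom)

lemma sym_gen_eq: "sym_gen V m = proj (word_monom C \<one>\<^bsub>C\<^esub> [m])"
  by (simp add: sym_gen_def tensor_gen_def proj_def free_gen_eq_monom)

lemma sym_gen_closed [simp, intro]: "m \<in> carrier M \<Longrightarrow> sym_gen V m \<in> carrier A"
  using ring_hom_closed[OF proj_hom] by (simp add: sym_gen_eq C.word_monom_carrier)

lemma sym_const_hom: "sym_const V \<in> ring_hom C A"
proof (rule ring_hom_memI)
  show "sym_const V c \<in> carrier A" if "c \<in> carrier C" for c
    using ring_hom_closed[OF proj_hom] that by (simp add: sym_const_eq C.word_monom_carrier)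
  show "sym_const V (c \<otimes>\<^bsub>C\<^esub> d) = sym_const V c \<otimes>\<^bsub>A\<^esub> sym_const V d" if "c \<in> carrier C" "d \<in> carrier C" for c d
    using that ring_hom_mult[OF proj_hom, of "word_monom C c []" "word_monom C d []"]
    by (simp add: sym_const_eq C.word_monom_carrier free_algebra_ops C.free_algebra_monom_mult)
  show "sym_const V (c \<oplus>\<^bsub>C\<^esub> d) = sym_const V c \<oplus>\<^bsub>A\<^esub> sym_const V d" if "c \<in> carrier C" "d \<in> carrier C" for c d
  proof -
    have "word_monom C (c \<oplus>\<^bsub>C\<^esub> d) [] = word_monom C c [] \<oplus>\<^bsub>F\<^esub> word_monom C d []"
      using that by (auto simp: free_algebra_ops word_monom_def)
    then show ?thesis
      using that ring_hom_add[OF proj_hom, of "word_monom C c []" "word_monom C d []"]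
      by (simp add: sym_const_eq C.word_monom_carrier)
  qed
  show "sym_const V \<one>\<^bsub>C\<^esub> = \<one>\<^bsub>A\<^esub>"
    using ring_hom_one[OF proj_hom] by (simp add: sym_const_eq free_algebra_ops)
qed

lemma sym_const_closed [simp, intro]: "c \<in> carrier C \<Longrightarrow> sym_const V c \<in> carrier A"
  by (rule ring_hom_closed[OF sym_const_hom])

lemma proj_eqI:
  assumes "x \<in> carrier F" "y \<in> carrier F" "x \<ominus>\<^bsub>F\<^esub> y \<in> tensor_rels"
  shows "proj x = proj y"
proof -
  have "x \<ominus>\<^bsub>F\<^esub> y \<in> tensor_ideal C M"
    using F.genideal_self[OF tensor_rels_closed] assms(3) by (auto simp: tensor_ideal_eq)
  then show ?thesis
    using I.quot_eqI[OF assms(1,2)] by (simp add: proj_def)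
qed

lemma sym_gen_add:
  assumes "m \<in> carrier M" "n \<in> carrier M"
  shows "sym_gen V (m \<oplus>\<^bsub>M\<^esub> n) = sym_gen V m \<oplus>\<^bsub>A\<^esub> sym_gen V n"
proof -
  have "proj (free_gen C (m \<oplus>\<^bsub>M\<^esub> n)) = proj (free_gen C m \<oplus>\<^bsub>F\<^esub> free_gen C n)"
    by (rule proj_eqI) (use assms in \<open>auto simp: free_gen_closed tensor_rels_def\<close>)
  then show ?thesis
    using assms ring_hom_add[OF proj_hom] by (simp add: sym_gen_eq free_gen_eq_monom C.word_monom_carrier)
qed

lemma sym_gen_smult:
  assumes "c \<in> carrier C" "m \<in> carrier M"
  shows "sym_gen V (c \<odot>\<^bsub>M\<^esub> m) = sym_const V c \<otimes>\<^bsub>A\<^esub> sym_gen V m"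
proof -
  have "proj (free_gen C (c \<odot>\<^bsub>M\<^esub> m)) = proj (free_const C c \<otimes>\<^bsub>F\<^esub> free_gen C m)"
    by (rule proj_eqI) (use assms in \<open>auto simp: free_gen_closed free_const_closed tensor_rels_def\<close>)
  then show ?thesis
    using assms ring_hom_mult[OF proj_hom]
    by (simp add: sym_gen_eq sym_const_eq free_gen_eq_monom free_const_eq_monom C.word_monom_carrier)
qed

text \<open>Holds before any quotient is taken: both products are the same word monomial.\<close>

lemma sym_const_gen_commute:
  assumes "c \<in> carrier C" "m \<in> carrier M"
  shows "sym_const V c \<otimes>\<^bsub>A\<^esub> sym_gen V m = sym_gen V m \<otimes>\<^bsub>A\<^esub> sym_const V c"
proof -
  have "word_monom C c [] \<otimes>\<^bsub>F\<^esub> word_monom C \<one>\<^bsub>C\<^esub> [m] = word_monom C \<one>\<^bsub>C\<^esub> [m] \<otimes>\<^bsub>F\<^esub> word_monom C c []"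
    using assms by (simp add: free_algebra_ops C.free_algebra_monom_mult)
  then show ?thesis
    using assms ring_hom_mult[OF proj_hom]
    by (metis C.one_closed C.word_monom_carrier Cons_in_lists_iff lists.Nil sym_const_eq sym_gen_eq)
qed

lemma sym_gen_commute:
  assumes "i \<noteq> 0" "j \<noteq> 0" "v \<in> gen_component V i" "w \<in> gen_component V j"
  shows "sym_gen V v \<otimes>\<^bsub>A\<^esub> sym_gen V w =
    (if odd i \<and> odd j then \<ominus>\<^bsub>A\<^esub> (sym_gen V w \<otimes>\<^bsub>A\<^esub> sym_gen V v) else sym_gen V w \<otimes>\<^bsub>A\<^esub> sym_gen V v)"
proof -
  interpret p: ring_hom_ring T A "\<lambda>x. symmetry_ideal V +>\<^bsub>T\<^esub> x"
    by (intro ring_hom_ringI2 T.ring_axioms A.ring_axioms coset_hom_T)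
  let ?g = "tensor_gen C M"
  let ?r = "if odd i \<and> odd j then \<ominus>\<^bsub>T\<^esub> (?g w \<otimes>\<^bsub>T\<^esub> ?g v) else ?g w \<otimes>\<^bsub>T\<^esub> ?g v"
  have closed: "?g v \<in> carrier T" "?g w \<in> carrier T"
    using assms by (auto intro!: tensor_gen_closed gen_component_closed)
  have "?g v \<otimes>\<^bsub>T\<^esub> ?g w \<ominus>\<^bsub>T\<^esub> ?r \<in> sym_rels"
    unfolding sym_rels_def using assms by blast
  then have "?g v \<otimes>\<^bsub>T\<^esub> ?g w \<ominus>\<^bsub>T\<^esub> ?r \<in> symmetry_ideal V"
    using T.genideal_self[OF sym_rels_closed] by (auto simp: symmetry_ideal_eq)
  then have "symmetry_ideal V +>\<^bsub>T\<^esub> (?g v \<otimes>\<^bsub>T\<^esub> ?g w) = symmetry_ideal V +>\<^bsub>T\<^esub> ?r"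
    using closed by (intro J.quot_eqI) auto
  moreover have "sym_gen V u = symmetry_ideal V +>\<^bsub>T\<^esub> ?g u" for u
    by (simp add: sym_gen_def)
  ultimately show ?thesis
    using closed by (simp split: if_splits)
qed

text \<open>A map is extended to the free algebra and descends twice: linearity of \<open>g\<close>
  kills \<open>tensor_rels\<close>, the sign rule kills \<open>sym_rels\<close>. The ring
  \<open>R\<close> need not be commutative, so compatibility of coefficients with generators is the
  separate hypothesis \<open>central\<close>.\<close>

lemma sym_algebra_universal:
  fixes R (structure)
  assumes "ring R" and \<gamma>: "\<gamma> \<in> ring_hom C R" and g: "g \<in> carrier M \<rightarrow> carrier R"
    and g_add: "\<And>m n. m \<in> carrier M \<Longrightarrow> n \<in> carrier M \<Longrightarrow> g (m \<oplus>\<^bsub>M\<^esub> n) = g m \<oplus> g n"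
    and g_smult: "\<And>c m. c \<in> carrier C \<Longrightarrow> m \<in> carrier M \<Longrightarrow> g (c \<odot>\<^bsub>M\<^esub> m) = \<gamma> c \<otimes> g m"
    and central: "\<And>c m. c \<in> carrier C \<Longrightarrow> m \<in> carrier M \<Longrightarrow> \<gamma> c \<otimes> g m = g m \<otimes> \<gamma> c"
    and comm: "\<And>i j v w. i \<noteq> 0 \<Longrightarrow> j \<noteq> 0 \<Longrightarrow> v \<in> gen_component V i \<Longrightarrow> w \<in> gen_component V j \<Longrightarrow>
       g v \<otimes> g w = (if odd i \<and> odd j then \<ominus> (g w \<otimes> g v) else g w \<otimes> g v)"
  obtains h where "h \<in> ring_hom A R" "\<And>c. c \<in> carrier C \<Longrightarrow> h (sym_const V c) = \<gamma> c"
    "\<And>m. m \<in> carrier M \<Longrightarrow> h (sym_gen V m) = g m"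
proof -
  interpret R: ring R by fact
  obtain h0 where h0: "h0 \<in> ring_hom F R"
    and h0_monom: "\<And>c w. c \<in> carrier C \<Longrightarrow> w \<in> lists (carrier M) \<Longrightarrow> h0 (word_monom C c w) = \<gamma> c \<otimes> word_prod R g w"
    using free_algebra_universal[OF C.is_cring \<open>ring R\<close> \<gamma> g central] by blast
  interpret h0: ring_hom_ring F R h0
    by (intro ring_hom_ringI2 F.ring_axioms R.ring_axioms h0)
  note \<gamma>_closed = ring_hom_closed[OF \<gamma>]
  have g_closed: "g m \<in> carrier R" if "m \<in> carrier M" for m
    using g that by auto
  have h0_const: "h0 (free_const C c) = \<gamma> c" if "c \<in> carrier C" for c
    using that \<gamma>_closed by (simp add: free_const_eq_monom h0_monom)
  have h0_gen: "h0 (free_gen C m) = g m" if "m \<in> carrier M" for m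
    using that g_closed ring_hom_one[OF \<gamma>] by (simp add: free_gen_eq_monom h0_monom)
  have h0_diff: "h0 (x \<ominus>\<^bsub>F\<^esub> y) = h0 x \<ominus> h0 y" if "x \<in> carrier F" "y \<in> carrier F" for x y
    using that by (simp add: a_minus_def)
  have "h0 x = \<zero>" if "x \<in> tensor_rels" for x
    using that
    by (auto simp: tensor_rels_def h0_diff h0_gen h0_const g_add g_smult g_closed \<gamma>_closed
        free_gen_closed free_const_closed R.r_neg a_minus_def)
  then obtain h1 where h1: "h1 \<in> ring_hom T R"
    and h1_eq: "\<And>x. x \<in> carrier F \<Longrightarrow> h1 (tensor_ideal C M +>\<^bsub>F\<^esub> x) = h0 x"
    unfolding T_eq tensor_ideal_eq
    using quotient_genideal_universal[OF F.ring_axioms \<open>ring R\<close> h0 tensor_rels_closed] by blast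
  interpret h1: ring_hom_ring T R h1
    by (intro ring_hom_ringI2 T.ring_axioms R.ring_axioms h1)
  have h1_gen: "h1 (tensor_gen C M m) = g m" if "m \<in> carrier M" for m
    using that by (simp add: tensor_gen_def h1_eq free_gen_closed h0_gen)
  have "h1 x = \<zero>" if rel: "x \<in> sym_rels" for x
  proof -
    obtain v w i j where x: "x = tensor_gen C M v \<otimes>\<^bsub>T\<^esub> tensor_gen C M w \<ominus>\<^bsub>T\<^esub>
              (if odd i \<and> odd j then \<ominus>\<^bsub>T\<^esub> (tensor_gen C M w \<otimes>\<^bsub>T\<^esub> tensor_gen C M v)
               else tensor_gen C M w \<otimes>\<^bsub>T\<^esub> tensor_gen C M v)"
      and ij: "i \<noteq> 0" "j \<noteq> 0" "v \<in> gen_component V i" "w \<in> gen_component V j"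
      using rel unfolding sym_rels_def by blast
    have vw: "v \<in> carrier M" "w \<in> carrier M"
      using ij gen_component_closed by auto
    show ?thesis
      unfolding x using comm[OF ij] vw tensor_gen_closed[OF vw(1)] tensor_gen_closed[OF vw(2)]
      by (auto simp: a_minus_def h1_gen g_closed R.r_neg R.l_neg split: if_splits)
  qed
  then obtain h where h: "h \<in> ring_hom A R"
    and h_eq: "\<And>x. x \<in> carrier T \<Longrightarrow> h (symmetry_ideal V +>\<^bsub>T\<^esub> x) = h1 x"
    unfolding sym_algebra_def symmetry_ideal_eq
    using quotient_genideal_universal[OF T.ring_axioms \<open>ring R\<close> h1 sym_rels_closed] by blast
  have h_proj: "h (proj x) = h0 x" if "x \<in> carrier F" for x
    using that ring_hom_closed[OF coset_hom_F that] by (simp add: proj_def h_eq h1_eq)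
  show thesis
    by (rule that[OF h]) (simp_all add: sym_const_eq sym_gen_eq h_proj C.word_monom_carrier
        h0_const[unfolded free_const_eq_monom] h0_gen[unfolded free_gen_eq_monom])
qed

end


section \<open>The polynomial filtration is finer than the weight filtration\<close>

context ring
begin

lemma add_generate_subgroup: "X \<subseteq> carrier R \<Longrightarrow> additive_subgroup (generate (add_monoid R) X) R"
  by (rule additive_subgroupI) (simp add: add.generate_is_subgroup)

lemma add_generate_closed: "X \<subseteq> carrier R \<Longrightarrow> x \<in> generate (add_monoid R) X \<Longrightarrow> x \<in> carrier R"
  using add.generate_in_carrier by auto

lemma add_generate_induct [consumes 2, case_names zero gen minus add]:
  assumes X: "X \<subseteq> carrier R" and "x \<in> generate (add_monoid R) X"
    and "P \<zero>" "\<And>x. x \<in> X \<Longrightarrow> P x"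
    and "\<And>x. x \<in> carrier R \<Longrightarrow> P x \<Longrightarrow> P (\<ominus> x)"
    and "\<And>x y. x \<in> carrier R \<Longrightarrow> y \<in> carrier R \<Longrightarrow> P x \<Longrightarrow> P y \<Longrightarrow> P (x \<oplus> y)"
  shows "P x"
  using assms(2)
proof (induction rule: generate.induct)
  case (inv h)
  then show ?case using assms X by (auto simp: a_inv_def[symmetric])
next
  case (eng x y)
  then show ?case using assms(6) add_generate_closed[OF X] by auto
qed (use assms in auto)

lemma add_generate_sub:
  assumes "X \<subseteq> carrier R" "additive_subgroup H R" "X \<subseteq> H"
  shows "generate (add_monoid R) X \<subseteq> H"
proof
  interpret H: additive_subgroup H R by fact
  fix x assume "x \<in> generate (add_monoid R) X"
  from assms(1) this show "x \<in> H"
    by (induction rule: add_generate_induct) (use assms(3) in auto)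
qed

text \<open>Distributivity, one factor at a time: a left factor from \<open>X\<close> is fixed while
  the right one varies over sums, then the right factor is fixed.\<close>

lemma add_generate_mult:
  assumes X: "X \<subseteq> carrier R" and Y: "Y \<subseteq> carrier R" and H: "additive_subgroup H R"
    and XY: "\<And>x y. x \<in> X \<Longrightarrow> y \<in> Y \<Longrightarrow> x \<otimes> y \<in> H"
    and x: "x \<in> generate (add_monoid R) X" and y: "y \<in> generate (add_monoid R) Y"
  shows "x \<otimes> y \<in> H"
proof -
  interpret H: additive_subgroup H R by fact
  have yc: "y \<in> carrier R" using add_generate_closed[OF Y y] .
  have *: "x \<otimes> y \<in> H" if "x \<in> X" for x
  proof -
    have xc: "x \<in> carrier R" using that X by blast
    from Y y show ?thesis
      by (induction rule: add_generate_induct) (use xc XY that in \<open>auto simp: r_distr r_minus\<close>)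
  qed
  from X x show ?thesis
    by (induction rule: add_generate_induct) (use yc * in \<open>auto simp: l_distr l_minus\<close>)
qed

end

section \<open>Monomials graded by length and by weight\<close>

context graded_space
begin

text \<open>Weights are stored beside the elements because an element does not determine its weight:
  zero lies in every \<open>gen_component\<close>.\<close>

definition homogeneous :: "(int \<times> 'v mod_elem) list \<Rightarrow> bool" where
  "homogeneous xs \<longleftrightarrow> (\<forall>(i, e)\<in>set xs. i \<noteq> 0 \<and> e \<in> gen_component V i)"

definition gen_prod :: "(int \<times> 'v mod_elem) list \<Rightarrow> 'v tens set" where
  "gen_prod xs = word_prod A (\<lambda>(i, e). sym_gen V e) xs"

definition monoms :: "nat \<Rightarrow> int \<Rightarrow> 'v tens set set" where
  "monoms k s = {sym_const V c \<otimes>\<^bsub>A\<^esub> gen_prod xs | c xs.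
     c \<in> carrier C \<and> homogeneous xs \<and> sum_list (map fst xs) = s \<and> k \<le> length xs}"

definition long_weight :: "nat \<Rightarrow> int \<Rightarrow> 'v tens set set" where
  "long_weight k s = generate (add_monoid A) (monoms k s)"

text \<open>Dropping the condition on the weight makes this an ideal, so that it can be compared
  with powers of an ideal. The estimate of positive weights, in contrast, needs the fixed weight of
  \<open>long_weight\<close>.\<close>

definition long :: "nat \<Rightarrow> 'v tens set set" where
  "long k = generate (add_monoid A) (\<Union>s. monoms k s)"

lemma homogeneous_simps [simp]:
  "homogeneous []" "homogeneous (x # xs) \<longleftrightarrow> fst x \<noteq> 0 \<and> snd x \<in> gen_component V (fst x) \<and> homogeneous xs"
  "homogeneous (xs @ ys) \<longleftrightarrow> homogeneous xs \<and> homogeneous ys"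
  by (auto simp: homogeneous_def)

lemma gens_closed: "homogeneous xs \<Longrightarrow> (\<lambda>(i, e). sym_gen V e) ` set xs \<subseteq> carrier A"
  using gen_component_closed by (fastforce simp: homogeneous_def)

lemma gen_prod_simps [simp]: "gen_prod [] = \<one>\<^bsub>A\<^esub>" "gen_prod (x # xs) = sym_gen V (snd x) \<otimes>\<^bsub>A\<^esub> gen_prod xs"
  by (simp_all add: gen_prod_def case_prod_beta)

lemma gen_prod_closed: "homogeneous xs \<Longrightarrow> gen_prod xs \<in> carrier A"
  unfolding gen_prod_def by (rule A.word_prod_closed[OF gens_closed])

lemma gen_prod_append: "homogeneous xs \<Longrightarrow> homogeneous ys \<Longrightarrow> gen_prod (xs @ ys) = gen_prod xs \<otimes>\<^bsub>A\<^esub> gen_prod ys"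
  unfolding gen_prod_def by (rule A.word_prod_append[OF gens_closed gens_closed])

lemma const_gen_prod_commute:
  assumes "c \<in> carrier C" "homogeneous xs"
  shows "sym_const V c \<otimes>\<^bsub>A\<^esub> gen_prod xs = gen_prod xs \<otimes>\<^bsub>A\<^esub> sym_const V c"
  unfolding gen_prod_def
  by (rule A.word_prod_commute[OF _ gens_closed])
    (use assms in \<open>auto simp: homogeneous_def sym_const_gen_commute gen_component_closed\<close>)

lemma monoms_closed: "monoms k s \<subseteq> carrier A" "(\<Union>s. monoms k s) \<subseteq> carrier A"
  by (auto simp: monoms_def gen_prod_closed)

lemma weight_monomials_eq: "weight_monomials V s = monoms 0 s"
proof -
  have "foldr (\<lambda>(i, e) a. sym_gen V e \<otimes>\<^bsub>A\<^esub> a) xs \<one>\<^bsub>A\<^esub> = gen_prod xs" for xs :: "(int \<times> 'v mod_elem) list"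
    by (induction xs) auto
  then show ?thesis
    by (simp add: weight_monomials_def monoms_def homogeneous_def)
qed

lemma weight_component_eq: "weight_component V s = long_weight 0 s"
  by (simp add: weight_component_def long_weight_def weight_monomials_eq)

lemma weight_component_closed: "weight_component V s \<subseteq> carrier A"
  unfolding weight_component_eq long_weight_def using A.add_generate_closed[OF monoms_closed(1)] by blast

lemma long_weight_subset: "long_weight k s \<subseteq> weight_component V s"
  unfolding weight_component_eq long_weight_def
  by (rule A.add.mono_generate) (auto simp: monoms_def)

sublocale long_weight: additive_subgroup "long_weight k s" A for k s
  unfolding long_weight_def by (rule A.add_generate_subgroup[OF monoms_closed(1)])

sublocale long: additive_subgroup "long k" A for k
  unfolding long_def by (rule A.add_generate_subgroup[OF monoms_closed(2)])

text \<open>Lengths add under concatenation, once the coefficient of the second monomial has been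
  moved past the letters of the first.\<close>

lemma long_mult:
  assumes "x \<in> long j" "y \<in> long k"
  shows "x \<otimes>\<^bsub>A\<^esub> y \<in> long (j + k)"
proof (rule A.add_generate_mult[OF monoms_closed(2) monoms_closed(2) long.additive_subgroup_axioms])
  show "x \<in> generate (add_monoid A) (\<Union>s. monoms j s)" "y \<in> generate (add_monoid A) (\<Union>s. monoms k s)"
    using assms by (simp_all add: long_def)
next
  fix x y assume "x \<in> (\<Union>s. monoms j s)" "y \<in> (\<Union>s. monoms k s)"
  then obtain c xs d ys where cd: "c \<in> carrier C" "d \<in> carrier C" "homogeneous xs" "homogeneous ys"
    and xy: "x = sym_const V c \<otimes>\<^bsub>A\<^esub> gen_prod xs" "y = sym_const V d \<otimes>\<^bsub>A\<^esub> gen_prod ys"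
    and len: "j \<le> length xs" "k \<le> length ys"
    by (auto simp: monoms_def)
  have "x \<otimes>\<^bsub>A\<^esub> y = sym_const V c \<otimes>\<^bsub>A\<^esub> (gen_prod xs \<otimes>\<^bsub>A\<^esub> sym_const V d) \<otimes>\<^bsub>A\<^esub> gen_prod ys"
    using cd by (simp add: xy A.m_assoc gen_prod_closed)
  also have "\<dots> = sym_const V c \<otimes>\<^bsub>A\<^esub> (sym_const V d \<otimes>\<^bsub>A\<^esub> gen_prod xs) \<otimes>\<^bsub>A\<^esub> gen_prod ys"
    using cd by (simp add: const_gen_prod_commute)
  also have "\<dots> = sym_const V (c \<otimes>\<^bsub>C\<^esub> d) \<otimes>\<^bsub>A\<^esub> gen_prod (xs @ ys)"
    using cd by (simp add: A.m_assoc gen_prod_closed gen_prod_append ring_hom_mult[OF sym_const_hom])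
  also have "\<dots> \<in> long (j + k)"
    unfolding long_def using cd len
    by (intro generate.incl UN_I[of "sum_list (map fst (xs @ ys))"] UNIV_I)
      (auto simp: monoms_def intro!: exI[of _ "c \<otimes>\<^bsub>C\<^esub> d"] exI[of _ "xs @ ys"])
  finally show "x \<otimes>\<^bsub>A\<^esub> y \<in> long (j + k)" .
qed

lemma const_gen_prod_in_long_weight:
  "c \<in> carrier C \<Longrightarrow> homogeneous xs \<Longrightarrow> k \<le> length xs \<Longrightarrow>
    sym_const V c \<otimes>\<^bsub>A\<^esub> gen_prod xs \<in> long_weight k (sum_list (map fst xs))"
  unfolding long_weight_def by (intro generate.incl) (auto simp: monoms_def)

lemma long_weight_in_long: "long_weight k s \<subseteq> long k"
  unfolding long_def long_weight_def by (rule A.add.mono_generate) auto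

lemma single_in_gen_component:
  assumes m: "m \<in> carrier M" and i: "i \<noteq> 0"
  shows "(\<lambda>j\<in>-{0}. if j = i then m i else \<zero>\<^bsub>tensor_module (V 0) (V j)\<^esub>) \<in> gen_component V i"
proof -
  have "abelian_group (tensor_module (V 0) (V j))" for j
    using tensor_pair.module_tensor_module[OF tensor_pair_V[of j]] by (simp add: module_def)
  then have "\<zero>\<^bsub>tensor_module (V 0) (V j)\<^esub> \<in> carrier (tensor_module (V 0) (V j))" for j
    by (simp add: abelian_group_def abelian_monoid.zero_closed)
  moreover have "finite {j \<in> -{0}. (if j = i then m i else \<zero>\<^bsub>tensor_module (V 0) (V j)\<^esub>) \<noteq> \<zero>\<^bsub>tensor_module (V 0) (V j)\<^esub>}"
    by (rule finite_subset[of _ "{i}"]) auto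
  ultimately show ?thesis
    using m i by (auto simp: gen_component_def gen_module_def direct_sum_carrier_iff cong: conj_cong)
qed

text \<open>A generator of \<open>A\<close> may be inhomogeneous, but it has finite support; the
  induction splits off one homogeneous component at a time and uses additivity of
  \<open>sym_gen\<close>.\<close>

lemma sym_gen_in_long_0:
  assumes "m \<in> carrier M"
  shows "sym_gen V m \<in> long 0"
proof -
  let ?Z = "\<lambda>j. \<zero>\<^bsub>tensor_module (V 0) (V j)\<^esub>"
  have fin: "finite {j \<in> -{0}. m j \<noteq> ?Z j}" if "m \<in> carrier M" for m
    using that by (simp add: gen_module_def direct_sum_carrier_iff)
  have ab: "abelian_monoid (tensor_module (V 0) (V j))" for j
    using tensor_pair.module_tensor_module[OF tensor_pair_V[of j]]
    by (simp add: module_def abelian_group_def)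
  have homog: "sym_gen V e \<in> long 0" if "e \<in> gen_component V i" "i \<noteq> 0" for e i
    using const_gen_prod_in_long_weight[of "\<one>\<^bsub>C\<^esub>" "[(i, e)]" 0] long_weight_in_long that
      gen_component_closed[OF that(1)] ring_hom_one[OF sym_const_hom] by auto
  from fin[OF assms] show ?thesis
    using assms
  proof (induction "{j \<in> -{0}. m j \<noteq> ?Z j}" arbitrary: m rule: finite_induct)
    case empty
    \<comment> \<open>With empty support \<open>m\<close> is zero, which belongs to every weight; 1
      is an arbitrary nonzero choice.\<close>
    then have "m \<in> gen_component V 1"
      by (auto simp: gen_component_def)
    then show ?case using homog by auto
  next
    case (insert i S)
    define e where "e = (\<lambda>j\<in>-{0}. if j = i then m i else ?Z j)"
    define m' where "m' = m(i := ?Z i)"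
    have i: "i \<noteq> 0" using insert.hyps by auto
    have e: "e \<in> gen_component V i"
      unfolding e_def by (rule single_in_gen_component[OF insert.prems i])
    have S: "S = {j \<in> -{0}. m' j \<noteq> ?Z j}"
      using insert.hyps(2,4) by (auto simp: m'_def)
    have m': "m' \<in> carrier M"
      using insert.prems insert.hyps(1) i ab unfolding S
      by (auto simp: gen_module_def direct_sum_carrier_iff m'_def extensional_def abelian_monoid.zero_closed)
    have "m = e \<oplus>\<^bsub>M\<^esub> m'"
      using insert.prems i ab
      by (auto simp: gen_module_def direct_sum_carrier_iff direct_sum_simps e_def m'_def extensional_def
          fun_eq_iff abelian_monoid.l_zero abelian_monoid.r_zero)
    then show ?case
      using sym_gen_add[OF gen_component_closed[OF e] m'] homog[OF e i] insert.hyps(3)[OF S m']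
      by auto
  qed
qed

text \<open>Elements of \<open>A\<close> are images of sums of words with arbitrary letters. Each
  letter and each coefficient lies in \<open>long 0\<close>, and \<open>long 0\<close> is closed
  under products by \<open>long_mult\<close>.\<close>

lemma carrier_subset_long_0: "carrier A \<subseteq> long 0"
proof
  fix a assume "a \<in> carrier A"
  then obtain f where f: "f \<in> carrier F" "a = proj f"
    using proj_surj by auto
  have const: "sym_const V c \<in> long 0" if "c \<in> carrier C" for c
    using const_gen_prod_in_long_weight[of c "[]" 0] long_weight_in_long that by auto
  have monom: "proj (word_monom C c u) \<in> long 0" if "c \<in> carrier C" "u \<in> lists (carrier M)" for c u
    using that(2)
  proof (induction u)
    case Nil
    then show ?case using const[OF that(1)] by (simp add: sym_const_eq)
  next
    case (Cons m u)
    have "word_monom C c (m # u) = word_monom C \<one>\<^bsub>C\<^esub> [m] \<otimes>\<^bsub>F\<^esub> word_monom C c u"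
      using that(1) by (simp add: free_algebra_ops C.free_algebra_monom_mult)
    then have "proj (word_monom C c (m # u)) = sym_gen V m \<otimes>\<^bsub>A\<^esub> proj (word_monom C c u)"
      using Cons.hyps that(1) ring_hom_mult[OF proj_hom] by (simp add: C.word_monom_carrier sym_gen_eq)
    then show ?case
      using long_mult[OF sym_gen_in_long_0[OF Cons.hyps(1)] Cons.IH] by simp
  qed
  from f(1) have "proj f \<in> long 0"
  proof (induction rule: C.free_algebra_induct)
    case zero
    then show ?case
      using ring_hom_zero[OF proj_hom F.ring_axioms A.ring_axioms]
      by (simp add: free_algebra_ops)
  next
    case (add c u f)
    then show ?case
      using monom ring_hom_add[OF proj_hom, of "word_monom C c u" f] by (simp add: C.word_monom_carrier)
  qed
  with f show "a \<in> long 0" by simp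
qed

text \<open>Absorption is \<open>long_mult\<close> with one index 0, since all of \<open>A\<close>
  is \<open>long 0\<close>.\<close>

lemma long_ideal: "ideal (long k) A"
proof (rule idealI)
  show "x \<otimes>\<^bsub>A\<^esub> a \<in> long k" "a \<otimes>\<^bsub>A\<^esub> x \<in> long k" if "a \<in> long k" "x \<in> carrier A" for a x
    using long_mult[of x 0 a k] long_mult[of a k x 0] that carrier_subset_long_0 by auto
qed (use A.ring_axioms long.a_subgroup in auto)

lemma pol_filtration_subset_long: "pol_filtration V p \<subseteq> long p"
proof -
  have "nonzero_weight_ideal V \<subseteq> long 1"
    unfolding nonzero_weight_ideal_def
  proof (rule A.genideal_minimal[OF long_ideal], rule UN_least)
    fix s :: int assume "s \<in> - {0}"
    \<comment> \<open>The empty list has weight 0, so a monomial of nonzero weight contains a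
      letter.\<close>
    then have "monoms 0 s \<subseteq> monoms 1 s"
      by (force simp: monoms_def Suc_le_eq)
    then have "weight_component V s \<subseteq> long_weight 1 s"
      unfolding weight_component_eq long_weight_def by (rule A.add.mono_generate)
    then show "weight_component V s \<subseteq> long 1"
      using long_weight_in_long by blast
  qed
  then show ?thesis
  proof (induction p)
    case 0
    then show ?case
      using carrier_subset_long_0 by (simp add: pol_filtration_def ideals_set_def nat_pow_def)
  next
    case (Suc p)
    show ?case
    proof
      fix x assume "x \<in> pol_filtration V (Suc p)"
      then have "x \<in> ideal_prod A (pol_filtration V p) (nonzero_weight_ideal V)"
        by (simp add: pol_filtration_def ideals_set_def nat_pow_def)
      then show "x \<in> long (Suc p)"
      proof (induction rule: ideal_prod.induct)
        case (prod i j)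
        then show ?case using long_mult[of i p j 1] Suc by auto
      qed auto
    qed
  qed
qed

section \<open>Real scalars and the endomorphism that detects weights\<close>

definition scalar :: "real \<Rightarrow> 'v fn" where
  "scalar a = (\<lambda>x\<in>V 0. a)"

definition scale_by :: "real \<Rightarrow> 'v tens set \<Rightarrow> 'v tens set" where
  "scale_by a x = sym_const V (scalar a) \<otimes>\<^bsub>A\<^esub> x"

lemma scalar_closed [simp]: "scalar a \<in> carrier C"
  unfolding scalar_def by (rule smooth_ring_const[OF V_subspace])

lemma scalar_mult: "scalar a \<otimes>\<^bsub>C\<^esub> scalar b = scalar (a * b)"
  by (simp add: scalar_def smooth_ring_ops fun_eq_iff)

lemma scalar_add: "scalar a \<oplus>\<^bsub>C\<^esub> scalar b = scalar (a + b)"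
  by (simp add: scalar_def smooth_ring_ops fun_eq_iff)

lemma scalar_one: "scalar 1 = \<one>\<^bsub>C\<^esub>"
  by (simp add: scalar_def smooth_ring_ops fun_eq_iff)

lemma scale_by_closed [simp]: "x \<in> carrier A \<Longrightarrow> scale_by a x \<in> carrier A"
  by (simp add: scale_by_def)

lemma scale_by_one: "x \<in> carrier A \<Longrightarrow> scale_by 1 x = x"
  by (simp add: scale_by_def scalar_one ring_hom_one[OF sym_const_hom])

lemma scale_by_scale_by: "x \<in> carrier A \<Longrightarrow> scale_by a (scale_by b x) = scale_by (a * b) x"
  by (simp add: scale_by_def A.m_assoc[symmetric] ring_hom_mult[OF sym_const_hom, symmetric] scalar_mult)

lemma scale_by_add_left: "x \<in> carrier A \<Longrightarrow> scale_by (a + b) x = scale_by a x \<oplus>\<^bsub>A\<^esub> scale_by b x"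
  by (simp add: scale_by_def A.l_distr[symmetric] ring_hom_add[OF sym_const_hom, symmetric] scalar_add)

lemma scale_by_diff_left:
  assumes "x \<in> carrier A"
  shows "scale_by (a - b) x = scale_by a x \<ominus>\<^bsub>A\<^esub> scale_by b x"
  using scale_by_add_left[OF assms, of "a - b" b] assms
  by (simp add: a_minus_def A.a_assoc A.r_neg)

lemma scale_by_const_gen_prod:
  assumes "c \<in> carrier C" "homogeneous xs"
  shows "scale_by a (sym_const V c \<otimes>\<^bsub>A\<^esub> gen_prod xs) = sym_const V (scalar a \<otimes>\<^bsub>C\<^esub> c) \<otimes>\<^bsub>A\<^esub> gen_prod xs"
  using assms by (simp add: scale_by_def A.m_assoc gen_prod_closed ring_hom_mult[OF sym_const_hom])

lemma scale_by_long_weight: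
  assumes "x \<in> long_weight k s"
  shows "scale_by a x \<in> long_weight k s"
proof -
  note x = assms[unfolded long_weight_def]
  show ?thesis
    using monoms_closed(1) x
  proof (induction rule: A.add_generate_induct)
    case (gen x)
    then obtain c xs where "c \<in> carrier C" "homogeneous xs" "sum_list (map fst xs) = s" "k \<le> length xs"
      "x = sym_const V c \<otimes>\<^bsub>A\<^esub> gen_prod xs"
      by (auto simp: monoms_def)
    then show ?case
      using const_gen_prod_in_long_weight[of "scalar a \<otimes>\<^bsub>C\<^esub> c" xs k] by (simp add: scale_by_const_gen_prod)
  qed (auto simp: scale_by_def A.r_minus A.r_distr)
qed

text \<open>Defined on inhomogeneous elements as well, because the universal property asks for a
  linear map on the whole module. Weights may be negative, hence \<open>powi\<close>.\<close>

definition weight_scaling :: "'v mod_elem \<Rightarrow> 'v mod_elem" where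
  "weight_scaling e = (\<lambda>i\<in>-{0}. scalar (2 powi i) \<odot>\<^bsub>tensor_module (V 0) (V i)\<^esub> e i)"

lemma module_component: "module C (tensor_module (V 0) (V i))"
  by (rule tensor_pair.module_tensor_module[OF tensor_pair_V])

lemma weight_scaling_closed: "e \<in> carrier M \<Longrightarrow> weight_scaling e \<in> carrier M"
proof -
  assume e: "e \<in> carrier M"
  have "{i \<in> -{0}. scalar (2 powi i) \<odot>\<^bsub>tensor_module (V 0) (V i)\<^esub> e i \<noteq> \<zero>\<^bsub>tensor_module (V 0) (V i)\<^esub>}
      \<subseteq> {i \<in> -{0}. e i \<noteq> \<zero>\<^bsub>tensor_module (V 0) (V i)\<^esub>}"
    using module.smult_r_null[OF module_component scalar_closed] by auto
  from finite_subset[OF this] e show ?thesis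
    using module.smult_closed[OF module_component scalar_closed]
    by (auto simp: gen_module_def direct_sum_carrier_iff weight_scaling_def cong: conj_cong)
qed

lemma weight_scaling_add:
  assumes "e \<in> carrier M" "f \<in> carrier M"
  shows "weight_scaling (e \<oplus>\<^bsub>M\<^esub> f) = weight_scaling e \<oplus>\<^bsub>M\<^esub> weight_scaling f"
  using assms module.smult_r_distr[OF module_component scalar_closed]
  by (auto simp: gen_module_def direct_sum_carrier_iff direct_sum_simps weight_scaling_def intro!: restrict_ext)

lemma weight_scaling_smult:
  assumes "c \<in> carrier C" "e \<in> carrier M"
  shows "weight_scaling (c \<odot>\<^bsub>M\<^esub> e) = c \<odot>\<^bsub>M\<^esub> weight_scaling e"
proof -
  have "scalar a \<odot>\<^bsub>tensor_module (V 0) (V i)\<^esub> (c \<odot>\<^bsub>tensor_module (V 0) (V i)\<^esub> m) =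
    c \<odot>\<^bsub>tensor_module (V 0) (V i)\<^esub> (scalar a \<odot>\<^bsub>tensor_module (V 0) (V i)\<^esub> m)"
    if "m \<in> carrier (tensor_module (V 0) (V i))" for a i m
    using assms(1) that C.m_comm[OF scalar_closed assms(1)]
    by (metis module.smult_assoc1[OF module_component] scalar_closed)
  then show ?thesis
    using assms
    by (auto simp: gen_module_def direct_sum_carrier_iff direct_sum_simps weight_scaling_def intro!: restrict_ext)
qed

lemma weight_scaling_gen_component:
  assumes "e \<in> gen_component V i" "i \<noteq> 0"
  shows "weight_scaling e = scalar (2 powi i) \<odot>\<^bsub>M\<^esub> e"
proof
  fix j
  show "weight_scaling e j = (scalar (2 powi i) \<odot>\<^bsub>M\<^esub> e) j"
    using assms module.smult_r_null[OF module_component scalar_closed]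
    by (cases "j = i"; cases "j = 0") (auto simp: weight_scaling_def gen_component_def gen_module_def direct_sum_simps)
qed

lemma weight_scaling_in_component:
  assumes "e \<in> gen_component V i" "i \<noteq> 0"
  shows "weight_scaling e \<in> gen_component V i"
  using assms weight_scaling_closed[of e] module.smult_r_null[OF module_component scalar_closed]
  by (auto simp: gen_component_def weight_scaling_def)

text \<open>\<open>weight_scaling\<close> is \<open>C\<close>-linear and preserves each
  \<open>gen_component\<close>, so its images obey the same sign rule and the universal property
  applies. On a monomial the real factors are collected in front, where the exponents add up to the
  total weight.\<close>

lemma weight_endomorphism:
  obtains \<Phi> where "\<Phi> \<in> ring_hom A A"
    "\<And>s x. x \<in> weight_component V s \<Longrightarrow> \<Phi> x = scale_by (2 powi s) x"
proof -
  obtain \<Phi> where \<Phi>: "\<Phi> \<in> ring_hom A A"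
    and \<Phi>_const: "\<And>c. c \<in> carrier C \<Longrightarrow> \<Phi> (sym_const V c) = sym_const V c"
    and \<Phi>_gen: "\<And>m. m \<in> carrier M \<Longrightarrow> \<Phi> (sym_gen V m) = sym_gen V (weight_scaling m)"
  proof (rule sym_algebra_universal[OF A.ring_axioms sym_const_hom, of "\<lambda>m. sym_gen V (weight_scaling m)"])
    fix i j v w assume "i \<noteq> 0" "j \<noteq> 0" "v \<in> gen_component V i" "w \<in> gen_component V j"
    then show "sym_gen V (weight_scaling v) \<otimes>\<^bsub>A\<^esub> sym_gen V (weight_scaling w) =
       (if odd i \<and> odd j then \<ominus>\<^bsub>A\<^esub> (sym_gen V (weight_scaling w) \<otimes>\<^bsub>A\<^esub> sym_gen V (weight_scaling v))
        else sym_gen V (weight_scaling w) \<otimes>\<^bsub>A\<^esub> sym_gen V (weight_scaling v))"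
      by (intro sym_gen_commute weight_scaling_in_component)
  qed (auto simp: weight_scaling_closed weight_scaling_add weight_scaling_smult sym_gen_add sym_gen_smult
      sym_const_gen_commute)
  interpret \<Phi>: ring_hom_ring A A \<Phi>
    by (intro ring_hom_ringI2 A.ring_axioms \<Phi>)
  have gen_prod: "\<Phi> (gen_prod xs) = scale_by (2 powi sum_list (map fst xs)) (gen_prod xs)" if "homogeneous xs" for xs
    using that
  proof (induction xs)
    case Nil
    then show ?case by (simp add: scale_by_one)
  next
    case (Cons x xs)
    let ?s = "sum_list (map fst xs)" and ?g = "sym_gen V (snd x)"
    have x: "fst x \<noteq> 0" "snd x \<in> gen_component V (fst x)" "snd x \<in> carrier M" "homogeneous xs"
      using Cons.prems by (auto intro: gen_component_closed)
    have "\<Phi> ?g = scale_by (2 powi fst x) ?g"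
      using x by (simp add: \<Phi>_gen weight_scaling_gen_component sym_gen_smult scale_by_def)
    then have "\<Phi> (gen_prod (x # xs)) = sym_const V (scalar (2 powi fst x)) \<otimes>\<^bsub>A\<^esub> (?g \<otimes>\<^bsub>A\<^esub> sym_const V (scalar (2 powi ?s))) \<otimes>\<^bsub>A\<^esub> gen_prod xs"
      using x Cons.IH by (simp add: gen_prod_closed scale_by_def A.m_assoc)
    also have "\<dots> = scale_by (2 powi fst x) (scale_by (2 powi ?s) (gen_prod (x # xs)))"
      using x by (simp add: sym_const_gen_commute[symmetric] scale_by_def A.m_assoc gen_prod_closed)
    also have "\<dots> = scale_by (2 powi (fst x + ?s)) (gen_prod (x # xs))"
      using Cons.prems gen_prod_closed[OF Cons.prems] by (simp add: scale_by_scale_by power_int_add)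
    finally show ?case by simp
  qed
  have "\<Phi> x = scale_by (2 powi s) x" if "x \<in> weight_component V s" for s x
  proof -
    note x = that[unfolded weight_component_eq long_weight_def]
    show ?thesis
      using monoms_closed(1) x
    proof (induction rule: A.add_generate_induct)
      case (gen x)
      then obtain c xs where "c \<in> carrier C" "homogeneous xs" "sum_list (map fst xs) = s"
        "x = sym_const V c \<otimes>\<^bsub>A\<^esub> gen_prod xs"
        by (auto simp: monoms_def)
      then show ?case
        by (simp add: \<Phi>_const gen_prod gen_prod_closed scale_by_def A.m_assoc[symmetric]
            ring_hom_mult[OF sym_const_hom, symmetric] C.m_comm)
    qed (auto simp: scale_by_def A.r_minus A.r_distr)
  qed
  then show thesis using \<Phi> that by blast
qed

text \<open>A nonzero real constant is invertible in \<open>C\<close>; this is the only division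
  that the eigenvector argument requires.\<close>

lemma scale_by_eq_zeroD:
  assumes "x \<in> carrier A" "scale_by a x = \<zero>\<^bsub>A\<^esub>" "a \<noteq> 0"
  shows "x = \<zero>\<^bsub>A\<^esub>"
proof -
  have "x = scale_by (1 / a) (scale_by a x)"
    using assms(1,3) by (simp add: scale_by_scale_by scale_by_one)
  also have "\<dots> = \<zero>\<^bsub>A\<^esub>"
    using assms(2) by (simp add: scale_by_def)
  finally show ?thesis .
qed

text \<open>Eigenvectors of \<open>weight_endomorphism\<close> for the distinct eigenvalues \<open>2\<^sup>s\<close> are independent.\<close>

lemma weight_components_independent:
  assumes "finite S" "\<And>s. y s \<in> weight_component V s" "finsum A y S = \<zero>\<^bsub>A\<^esub>" "r \<in> S"
  shows "y r = \<zero>\<^bsub>A\<^esub>"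
proof -
  obtain \<Phi> where \<Phi>: "\<Phi> \<in> ring_hom A A"
    and \<Phi>_eq: "\<And>s x. x \<in> weight_component V s \<Longrightarrow> \<Phi> x = scale_by (2 powi s) x"
    using weight_endomorphism by blast
  interpret \<Phi>: ring_hom_ring A A \<Phi>
    by (intro ring_hom_ringI2 A.ring_axioms \<Phi>)
  show ?thesis
    using assms
  proof (induction S arbitrary: y r rule: finite_induct)
    case (insert s S)
    have y: "y t \<in> carrier A" for t
      using insert.prems(1)[of t] by (simp add: weight_component_eq)
    \<comment> \<open>Applying \<Phi> - 2^s to the vanishing sum multiplies \<open>y t\<close> by
      2^t - 2^s. The term at \<open>s\<close> disappears and a shorter relation remains.\<close>
    define z where "z t = scale_by (2 powi t - 2 powi s) (y t)" for t
    have "z t = \<Phi> (y t) \<oplus>\<^bsub>A\<^esub> scale_by (- (2 powi s)) (y t)" for t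
      using scale_by_add_left[OF y, of "2 powi t" "- (2 powi s)" t]
      by (simp add: z_def \<Phi>_eq[OF insert.prems(1)])
    then have "finsum A z (insert s S) = (\<Oplus>\<^bsub>A\<^esub>t\<in>insert s S. \<Phi> (y t) \<oplus>\<^bsub>A\<^esub> scale_by (- (2 powi s)) (y t))"
      by presburger
    also have "\<dots> = (\<Oplus>\<^bsub>A\<^esub>t\<in>insert s S. \<Phi> (y t)) \<oplus>\<^bsub>A\<^esub> (\<Oplus>\<^bsub>A\<^esub>t\<in>insert s S. scale_by (- (2 powi s)) (y t))"
      using y by (intro A.finsum_addf) auto
    also have "(\<Oplus>\<^bsub>A\<^esub>t\<in>insert s S. \<Phi> (y t)) = \<Phi> (finsum A y (insert s S))"
      using y by (subst \<Phi>.hom_finsum) (auto simp: comp_def)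
    also have "(\<Oplus>\<^bsub>A\<^esub>t\<in>insert s S. scale_by (- (2 powi s)) (y t)) = scale_by (- (2 powi s)) (finsum A y (insert s S))"
      unfolding scale_by_def using y insert.hyps(1) by (subst A.finsum_rdistr) auto
    finally have "finsum A z (insert s S) = \<zero>\<^bsub>A\<^esub>"
      using insert.prems(2) by (simp add: scale_by_def)
    \<comment> \<open>The factor is 0 here; that scaling by 0 gives zero follows by writing 0 as 0 -
      0.\<close>
    moreover have "z s = \<zero>\<^bsub>A\<^esub>"
      using y scale_by_diff_left[of "y s" 0 0] by (simp add: z_def A.r_neg a_minus_def)
    moreover have zc: "z t \<in> carrier A" for t
      by (simp add: z_def y)
    ultimately have "finsum A z S = \<zero>\<^bsub>A\<^esub>"
      using insert.hyps by simp
    moreover have "z t \<in> weight_component V t" for t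
      using insert.prems(1) scale_by_long_weight[of _ 0] by (simp add: z_def weight_component_eq)
    ultimately have z0: "z t = \<zero>\<^bsub>A\<^esub>" if "t \<in> S" for t
      using insert.IH that by blast
    have y0: "y t = \<zero>\<^bsub>A\<^esub>" if "t \<in> S" for t
    proof (rule scale_by_eq_zeroD[OF y])
      show "scale_by (2 powi t - 2 powi s) (y t) = \<zero>\<^bsub>A\<^esub>"
        using z0[OF that] by (simp add: z_def)
      have "t \<noteq> s" using that insert.hyps by auto
      then show "2 powi t - 2 powi s \<noteq> (0::real)"
        using power_int_strict_increasing[of t s "2::real"] power_int_strict_increasing[of s t "2::real"]
        by (cases "t < s") auto
    qed
    then have "finsum A y S = \<zero>\<^bsub>A\<^esub>"
      using A.finsum_cong'[of S S "\<lambda>_. \<zero>\<^bsub>A\<^esub>" y] by simp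
    then have "y s = \<zero>\<^bsub>A\<^esub>"
      using insert.prems(2) insert.hyps y by simp
    then show ?case using y0 insert.prems(3) by auto
  qed simp
qed

text \<open>The family is indexed by all integers and vanishes off \<open>S\<close>, so that
  decompositions with different index sets can be added over their union.\<close>

lemma long_decomposition:
  assumes "x \<in> long k"
  obtains S y where "finite S" "\<And>s. y s \<in> long_weight k s" "\<And>s. s \<notin> S \<Longrightarrow> y s = \<zero>\<^bsub>A\<^esub>" "x = finsum A y S"
proof -
  note x = assms[unfolded long_def]
  have "\<exists>S y. finite S \<and> (\<forall>s. y s \<in> long_weight k s) \<and> (\<forall>s. s \<notin> S \<longrightarrow> y s = \<zero>\<^bsub>A\<^esub>) \<and> x = finsum A y S"
    using monoms_closed(2) x
  proof (induction rule: A.add_generate_induct)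
    case zero
    show ?case
      by (intro exI[of _ "{}"] exI[of _ "\<lambda>_. \<zero>\<^bsub>A\<^esub>"]) auto
  next
    case (gen x)
    then obtain s where s: "x \<in> long_weight k s"
      unfolding long_weight_def by (auto intro: generate.incl)
    then show ?case
      by (intro exI[of _ "{s}"] exI[of _ "\<lambda>t. if t = s then x else \<zero>\<^bsub>A\<^esub>"]) auto
  next
    case (minus x)
    then obtain S y where S: "finite S" "\<forall>s. y s \<in> long_weight k s" "\<forall>s. s \<notin> S \<longrightarrow> y s = \<zero>\<^bsub>A\<^esub>" "x = finsum A y S"
      by blast
    have yc: "y s \<in> carrier A" for s using S(2) long_weight.a_subset by blast
    have "finsum A (\<lambda>s. y s \<oplus>\<^bsub>A\<^esub> \<ominus>\<^bsub>A\<^esub> y s) S = finsum A y S \<oplus>\<^bsub>A\<^esub> finsum A (\<lambda>s. \<ominus>\<^bsub>A\<^esub> y s) S"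
      using yc by (intro A.finsum_addf) auto
    moreover have "finsum A (\<lambda>s. y s \<oplus>\<^bsub>A\<^esub> \<ominus>\<^bsub>A\<^esub> y s) S = \<zero>\<^bsub>A\<^esub>"
      using yc by (simp add: A.r_neg)
    ultimately have "\<ominus>\<^bsub>A\<^esub> x = finsum A (\<lambda>s. \<ominus>\<^bsub>A\<^esub> y s) S"
      using yc S(4) by (intro A.minus_equality) (auto simp: A.a_comm)
    with S show ?case
      by (intro exI[of _ S] exI[of _ "\<lambda>s. \<ominus>\<^bsub>A\<^esub> y s"]) auto
  next
    case (add x x')
    then obtain S y S' y' where S: "finite S" "\<forall>s. y s \<in> long_weight k s" "\<forall>s. s \<notin> S \<longrightarrow> y s = \<zero>\<^bsub>A\<^esub>" "x = finsum A y S"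
      and S': "finite S'" "\<forall>s. y' s \<in> long_weight k s" "\<forall>s. s \<notin> S' \<longrightarrow> y' s = \<zero>\<^bsub>A\<^esub>" "x' = finsum A y' S'"
      by blast
    have c: "y s \<in> carrier A" "y' s \<in> carrier A" for s
      using S(2) S'(2) long_weight.a_subset by blast+
    have "x = finsum A y (S \<union> S')"
      unfolding S(4) by (rule A.add.finprod_mono_neutral_cong_left) (use S S' c in auto)
    moreover have "x' = finsum A y' (S \<union> S')"
      unfolding S'(4) by (rule A.add.finprod_mono_neutral_cong_left) (use S S' c in auto)
    ultimately have "x \<oplus>\<^bsub>A\<^esub> x' = finsum A (\<lambda>s. y s \<oplus>\<^bsub>A\<^esub> y' s) (S \<union> S')"
      using c by (simp add: A.finsum_addf)
    with S S' show ?case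
      by (intro exI[of _ "S \<union> S'"] exI[of _ "\<lambda>s. y s \<oplus>\<^bsub>A\<^esub> y' s"]) auto
  qed
  then show thesis using that by blast
qed

lemma long_inter_weight_component:
  assumes x: "x \<in> long k" and xr: "x \<in> weight_component V r"
  shows "x \<in> long_weight k r"
proof -
  obtain S y where S: "finite S" "\<And>s. y s \<in> long_weight k s" "\<And>s. s \<notin> S \<Longrightarrow> y s = \<zero>\<^bsub>A\<^esub>" "x = finsum A y S"
    using long_decomposition[OF x] by blast
  have yc: "y s \<in> carrier A" for s using S(2) long_weight.a_subset by blast
  have xc: "x \<in> carrier A" using x by auto
  \<comment> \<open>The identity between \<open>x\<close> and the sum of the \<open>y s\<close>
    becomes a vanishing sum by subtracting \<open>x\<close> in weight \<open>r\<close>. Independence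
    then yields \<open>y r = x\<close>, and \<open>x\<close> inherits the length bound of
    \<open>y r\<close>. Inserting \<open>r\<close> into the index set is harmless because
    \<open>y\<close> vanishes off \<open>S\<close>.\<close>
  define z where "z s = y s \<oplus>\<^bsub>A\<^esub> (if r = s then \<ominus>\<^bsub>A\<^esub> x else \<zero>\<^bsub>A\<^esub>)" for s
  let ?S = "insert r S"
  have "finsum A z ?S = finsum A y ?S \<oplus>\<^bsub>A\<^esub> finsum A (\<lambda>s. if r = s then \<ominus>\<^bsub>A\<^esub> x else \<zero>\<^bsub>A\<^esub>) ?S"
    unfolding z_def using yc xc by (intro A.finsum_addf) auto
  also have "finsum A y ?S = x"
    unfolding S(4) using S(1,3) yc by (intro A.add.finprod_mono_neutral_cong_right) auto
  also have "finsum A (\<lambda>s. if r = s then \<ominus>\<^bsub>A\<^esub> x else \<zero>\<^bsub>A\<^esub>) ?S = \<ominus>\<^bsub>A\<^esub> x"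
    using S(1) xc A.finsum_singleton[of r ?S "\<lambda>_. \<ominus>\<^bsub>A\<^esub> x"] by simp
  finally have "finsum A z ?S = \<zero>\<^bsub>A\<^esub>"
    using xc by (simp add: A.r_neg)
  moreover have "z s \<in> weight_component V s" for s
    using subsetD[OF long_weight_subset S(2)] xr by (auto simp: z_def weight_component_eq)
  ultimately have "z r = \<zero>\<^bsub>A\<^esub>"
    using S(1) weight_components_independent[of ?S z r] by auto
  then have "y r = x"
    using yc[of r] xc A.minus_equality[of "y r" "\<ominus>\<^bsub>A\<^esub> x"] by (simp add: z_def)
  then show ?thesis using S(2) by metis
qed

section \<open>Moving the letters of positive weight to the front\<close>

text \<open>Each exchange of neighbours costs at most a sign. Leaving the total sign undetermined
  suffices, since ideals are closed under negation.\<close>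

lemma gen_gen_prod_commute:
  assumes "i \<noteq> 0" "e \<in> gen_component V i" "homogeneous xs"
  shows "sym_gen V e \<otimes>\<^bsub>A\<^esub> gen_prod xs = gen_prod xs \<otimes>\<^bsub>A\<^esub> sym_gen V e \<or>
    sym_gen V e \<otimes>\<^bsub>A\<^esub> gen_prod xs = \<ominus>\<^bsub>A\<^esub> (gen_prod xs \<otimes>\<^bsub>A\<^esub> sym_gen V e)"
  using assms(3)
proof (induction xs)
  case Nil
  then show ?case using gen_component_closed[OF assms(2)] by simp
next
  case (Cons x xs)
  let ?e = "sym_gen V e" and ?x = "sym_gen V (snd x)" and ?m = "gen_prod xs"
  have c: "?e \<in> carrier A" "?x \<in> carrier A" "?m \<in> carrier A"
    using Cons.prems assms gen_component_closed by (auto simp: gen_prod_closed)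
  have "?e \<otimes>\<^bsub>A\<^esub> ?x = ?x \<otimes>\<^bsub>A\<^esub> ?e \<or> ?e \<otimes>\<^bsub>A\<^esub> ?x = \<ominus>\<^bsub>A\<^esub> (?x \<otimes>\<^bsub>A\<^esub> ?e)"
    using sym_gen_commute[of i "fst x" e "snd x"] Cons.prems assms by simp
  moreover have "?e \<otimes>\<^bsub>A\<^esub> (?x \<otimes>\<^bsub>A\<^esub> ?m) = ?e \<otimes>\<^bsub>A\<^esub> ?x \<otimes>\<^bsub>A\<^esub> ?m"
    using c by (simp add: A.m_assoc)
  ultimately have 1: "?e \<otimes>\<^bsub>A\<^esub> (?x \<otimes>\<^bsub>A\<^esub> ?m) = ?x \<otimes>\<^bsub>A\<^esub> (?e \<otimes>\<^bsub>A\<^esub> ?m) \<or>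
      ?e \<otimes>\<^bsub>A\<^esub> (?x \<otimes>\<^bsub>A\<^esub> ?m) = \<ominus>\<^bsub>A\<^esub> (?x \<otimes>\<^bsub>A\<^esub> (?e \<otimes>\<^bsub>A\<^esub> ?m))"
    using c by (elim disjE) (simp_all add: A.l_minus A.m_assoc)
  have 2: "?e \<otimes>\<^bsub>A\<^esub> ?m = ?m \<otimes>\<^bsub>A\<^esub> ?e \<or> ?e \<otimes>\<^bsub>A\<^esub> ?m = \<ominus>\<^bsub>A\<^esub> (?m \<otimes>\<^bsub>A\<^esub> ?e)"
    using Cons by simp
  from 1 2 show ?case
    using c by (elim disjE) (simp_all add: A.r_minus A.m_assoc)
qed

text \<open>A letter of negative weight at the head is carried past the positive letters already
  gathered; a positive one stays where it is.\<close>

lemma gen_prod_positive_first: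
  assumes "homogeneous xs"
  defines "p \<equiv> filter (\<lambda>x. fst x > 0) xs" and "n \<equiv> filter (\<lambda>x. \<not> fst x > 0) xs"
  shows "gen_prod xs = gen_prod p \<otimes>\<^bsub>A\<^esub> gen_prod n \<or> gen_prod xs = \<ominus>\<^bsub>A\<^esub> (gen_prod p \<otimes>\<^bsub>A\<^esub> gen_prod n)"
  using assms(1) unfolding p_def n_def
proof (induction xs)
  case (Cons x xs)
  let ?x = "sym_gen V (snd x)" and ?p = "gen_prod (filter (\<lambda>x. fst x > 0) xs)"
    and ?n = "gen_prod (filter (\<lambda>x. \<not> fst x > 0) xs)"
  have hp: "homogeneous (filter (\<lambda>x. fst x > 0) xs)" "homogeneous (filter (\<lambda>x. \<not> fst x > 0) xs)"
    using Cons.prems by (auto simp: homogeneous_def)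
  have c: "?x \<in> carrier A" "?p \<in> carrier A" "?n \<in> carrier A"
    using gen_prod_closed[OF hp(1)] gen_prod_closed[OF hp(2)] Cons.prems gen_component_closed[of "snd x"] by auto
  have IH: "gen_prod xs = ?p \<otimes>\<^bsub>A\<^esub> ?n \<or> gen_prod xs = \<ominus>\<^bsub>A\<^esub> (?p \<otimes>\<^bsub>A\<^esub> ?n)"
    using Cons by simp
  show ?case
  proof (cases "fst x > 0")
    case True
    with IH show ?thesis
      using c by (elim disjE) (simp_all add: A.r_minus A.m_assoc)
  next
    case False
    have "?x \<otimes>\<^bsub>A\<^esub> ?p = ?p \<otimes>\<^bsub>A\<^esub> ?x \<or> ?x \<otimes>\<^bsub>A\<^esub> ?p = \<ominus>\<^bsub>A\<^esub> (?p \<otimes>\<^bsub>A\<^esub> ?x)"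
      using gen_gen_prod_commute[of "fst x" "snd x"] Cons.prems hp(1) by simp
    then have "?x \<otimes>\<^bsub>A\<^esub> (?p \<otimes>\<^bsub>A\<^esub> ?n) = ?p \<otimes>\<^bsub>A\<^esub> (?x \<otimes>\<^bsub>A\<^esub> ?n) \<or>
        ?x \<otimes>\<^bsub>A\<^esub> (?p \<otimes>\<^bsub>A\<^esub> ?n) = \<ominus>\<^bsub>A\<^esub> (?p \<otimes>\<^bsub>A\<^esub> (?x \<otimes>\<^bsub>A\<^esub> ?n))"
      using c by (elim disjE) (simp_all add: A.m_assoc[symmetric] A.l_minus)
    with IH show ?thesis
      using False c by (elim disjE) (simp_all add: A.r_minus)
  qed
qed simp

text \<open>Let P be the sum of the positive weights and N that of the absolute values of the
  negative ones. The total weight is P - N, and the length is at most P + N because the weights are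
  nonzero integers. Adding the two gives the factor 2.\<close>

lemma positive_weight_bound:
  assumes "homogeneous xs"
  shows "int (length xs) + sum_list (map fst xs) \<le> 2 * sum_list (map fst (filter (\<lambda>x. fst x > 0) xs))"
  using assms by (induction xs) auto

lemma weight_filtration_ideal: "ideal (weight_filtration V p) A"
proof (cases "p = 0")
  case True
  then show ?thesis by (simp add: weight_filtration_def A.oneideal)
next
  case False
  then show ?thesis
    unfolding weight_filtration_def
    using weight_component_closed by (auto intro!: A.genideal_ideal)
qed

lemma weight_component_subset_filtration:
  assumes "int p \<le> s"
  shows "weight_component V s \<subseteq> weight_filtration V p"
proof (cases "p = 0")
  case True
  then show ?thesis using weight_component_closed by (auto simp: weight_filtration_def)
next
  case False
  have "(\<Union>r\<in>{int p..}. weight_component V r) \<subseteq> weight_filtration V p"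
    using False A.genideal_self[of "\<Union>r\<in>{int p..}. weight_component V r"] weight_component_closed
    by (simp add: weight_filtration_def UN_least)
  then show ?thesis using assms by auto
qed

text \<open>The inequality forces the positive letters to have total weight at least
  \<open>p\<close>, by \<open>positive_weight_bound\<close>; the ideal absorbs the remaining
  letters, the sign and the coefficient. The alternative \<open>p = 0\<close> accommodates indices
  cut off at 0.\<close>

lemma long_weight_subset_filtration:
  assumes "2 * int p \<le> int k + r \<or> p = 0"
  shows "long_weight k r \<subseteq> weight_filtration V p"
proof -
  interpret W: ideal "weight_filtration V p" A by (rule weight_filtration_ideal)
  show ?thesis
  proof (cases "p = 0")
    case True
    then show ?thesis by (auto simp: weight_filtration_def)
  next
    case False
    show ?thesis
      unfolding long_weight_def
    proof (rule A.add_generate_sub[OF monoms_closed(1) W.additive_subgroup_axioms], rule subsetI)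
      fix x assume "x \<in> monoms k r"
      then obtain c xs where x: "c \<in> carrier C" "homogeneous xs" "sum_list (map fst xs) = r" "k \<le> length xs"
        "x = sym_const V c \<otimes>\<^bsub>A\<^esub> gen_prod xs"
        by (auto simp: monoms_def)
      let ?p = "filter (\<lambda>x. fst x > 0) xs" and ?n = "filter (\<lambda>x. \<not> fst x > 0) xs"
      have h: "homogeneous ?p" "homogeneous ?n"
        using x(2) by (auto simp: homogeneous_def)
      have "gen_prod ?p \<in> weight_component V (sum_list (map fst ?p))"
        using const_gen_prod_in_long_weight[of "\<one>\<^bsub>C\<^esub>" ?p 0] h
        by (simp add: weight_component_eq ring_hom_one[OF sym_const_hom] gen_prod_closed)
      moreover have "int p \<le> sum_list (map fst ?p)"
        using positive_weight_bound[OF x(2)] x(3,4) assms False by linarith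
      ultimately have "gen_prod ?p \<otimes>\<^bsub>A\<^esub> gen_prod ?n \<in> weight_filtration V p"
        using weight_component_subset_filtration h by (auto intro!: W.I_r_closed gen_prod_closed)
      then have "gen_prod xs \<in> weight_filtration V p"
        using gen_prod_positive_first[OF x(2)] W.a_inv_closed by metis
      then show "x \<in> weight_filtration V p"
        using x by (auto intro!: W.I_l_closed)
    qed
  qed
qed

theorem pol_filtration_le_weight_filtration:
  "filtration_le (induced_filtration (pol_filtration V) (weight_component V r))
     (induced_filtration (weight_filtration V) (weight_component V r))"
  unfolding filtration_le_def
proof (intro exI conjI allI)
  \<comment> \<open>For \<open>k < - r\<close> the quotient is negative and \<open>nat\<close>
    replaces it by 0, where the filtration is all of \<open>A\<close>. Only finitely many
    \<open>k\<close> are affected.\<close>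
  let ?l = "\<lambda>k. nat ((int k + r) div 2)"
  show "mono ?l"
    by (intro monoI nat_mono zdiv_mono1) auto
  show "\<not> bdd_above (range ?l)"
  proof
    assume "bdd_above (range ?l)"
    then obtain b where b: "\<And>k. ?l k \<le> b" by (auto simp: bdd_above_def)
    \<comment> \<open>Chosen so that the quotient is at least \<open>b + 1\<close>; if
      \<open>r\<close> exceeds \<open>2 * (b + 1)\<close>, already \<open>k = 0\<close> has this
      property.\<close>
    define k where "k = nat (2 * (int b + 1) - r)"
    have "2 * (int b + 1) \<le> int k + r" by (simp add: k_def)
    then have "int b + 1 \<le> (int k + r) div 2" by presburger
    with b[of k] show False by linarith
  qed
  fix k
  have "2 * int (?l k) \<le> int k + r \<or> ?l k = 0" by linarith
  then show "induced_filtration (pol_filtration V) (weight_component V r) k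
      \<subseteq> induced_filtration (weight_filtration V) (weight_component V r) (?l k)"
    using pol_filtration_subset_long[of k] long_inter_weight_component long_weight_subset_filtration
    unfolding induced_filtration_def by blast
qed

end


section \<open>The weight filtration need not be finer than the polynomial filtration\<close>

text \<open>Presents a type-class ring as a record, with two uses: the reals as additive target of a
  functional, and real polynomials as target of a homomorphism from \<open>A\<close>.\<close>

definition class_ring :: "'a::comm_ring_1 ring" where
  "class_ring = \<lparr>carrier = UNIV, mult = (*), one = 1, zero = 0, add = (+)\<rparr>"

lemma class_ring_simps [simp]:
  "carrier class_ring = UNIV" "x \<otimes>\<^bsub>class_ring\<^esub> y = x * y" "\<one>\<^bsub>class_ring\<^esub> = 1"
  "\<zero>\<^bsub>class_ring\<^esub> = 0" "x \<oplus>\<^bsub>class_ring\<^esub> y = x + y"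
  by (simp_all add: class_ring_def)

lemma cring_class_ring: "cring (class_ring :: 'a::comm_ring_1 ring)"
proof (rule cringI)
  show "abelian_group (class_ring :: 'a ring)"
    by (rule abelian_groupI) (auto intro: exI[of _ "- x" for x] simp: add.assoc add.commute left_minus)
  show "comm_monoid (class_ring :: 'a ring)"
    by (rule comm_monoidI) (auto simp: mult.assoc mult.commute)
qed (auto simp: distrib_right)

interpretation class_ring: cring class_ring
  by (rule cring_class_ring)

lemma class_ring_minus [simp]: "\<ominus>\<^bsub>class_ring\<^esub> x = - x"
  by (rule class_ring.minus_equality) auto

text \<open>The principal ideal of \<open>p\<close>; for powers of X its preimage in
  \<open>A\<close> bounds the image of \<open>long\<close>.\<close>

lemma ideal_class_ring_dvd: "ideal {x. p dvd x} (class_ring :: 'a::comm_ring_1 ring)"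
proof (rule idealI)
  show "subgroup {x. p dvd x} (add_monoid (class_ring :: 'a ring))"
    by (rule class_ring.add.subgroupI) (auto simp: a_inv_def[symmetric])
qed (auto simp: class_ring.ring_axioms)

text \<open>The assignment of c(0) \<theta>(w) to the tensor of c and w is balanced, since
  evaluation is linear over the reals. The point 0 is available because it lies in every
  subspace.\<close>

lemma (in tensor_pair) evaluation_functional:
  fixes \<theta> :: "'v \<Rightarrow> real"
  assumes \<theta>: "linear \<theta>"
  obtains \<epsilon> where "\<epsilon> \<in> hom (add_monoid M) (add_monoid class_ring)"
    "\<And>c X. c \<in> carrier C \<Longrightarrow> X \<in> carrier M \<Longrightarrow> \<epsilon> (c \<odot>\<^bsub>M\<^esub> X) = c 0 * \<epsilon> X"
    "\<And>c w. c \<in> carrier C \<Longrightarrow> w \<in> W \<Longrightarrow> \<epsilon> (pure c w) = c 0 * \<theta> w"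
proof -
  have 0: "0 \<in> U" using U by (rule subspace_0)
  obtain \<epsilon> where hom: "\<epsilon> \<in> hom (add_monoid M) (add_monoid class_ring)"
    and pure: "\<And>c w. c \<in> carrier C \<Longrightarrow> w \<in> W \<Longrightarrow> \<epsilon> (pure c w) = c 0 * \<theta> w"
    by (rule tensor_module_universal[of class_ring "\<lambda>c w. c 0 * \<theta> w"])
      (use 0 in \<open>auto simp: smooth_ring_ops algebra_simps linear_add[OF \<theta>] linear_scale[OF \<theta>]
        intro: class_ring.abelian_group_axioms\<close>)
  have add: "\<epsilon> (X \<oplus>\<^bsub>M\<^esub> Y) = \<epsilon> X + \<epsilon> Y" if "X \<in> carrier M" "Y \<in> carrier M" for X Y
    using hom that by (simp add: hom_def)
  have cl: "H #>\<^bsub>G\<^esub> x \<in> carrier M" if "x \<in> carrier G" for x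
    using that by (auto simp: tensor_module_carrier simp del: carrier_free_Abelian_group_iff)
  have \<epsilon>_diff: "\<epsilon> (H #>\<^bsub>G\<^esub> (x - y)) = \<epsilon> (H #>\<^bsub>G\<^esub> x) - \<epsilon> (H #>\<^bsub>G\<^esub> y)" if "x \<in> carrier G" "y \<in> carrier G" for x y
    using add[OF cl[OF carrier_G_diff[OF that]] cl[OF that(2)]] tensor_module_add[OF carrier_G_diff[OF that] that(2)]
    by simp
  have "\<epsilon> (c \<odot>\<^bsub>M\<^esub> X) = c 0 * \<epsilon> X" if c: "c \<in> carrier C" and X: "X \<in> carrier M" for c X
  proof -
    obtain x where x: "x \<in> carrier G" "X = H #>\<^bsub>G\<^esub> x"
      using X by (auto simp: tensor_module_carrier)
    \<comment> \<open>The universal property supplies additivity alone, so compatibility with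
      \<open>c\<close> is checked on representatives. Membership is carried through the induction
      because splitting the coset of a difference requires it.\<close>
    from x(1) have "x \<in> carrier G \<and> \<epsilon> (H #>\<^bsub>G\<^esub> scale c x) = c 0 * \<epsilon> (H #>\<^bsub>G\<^esub> x)"
      unfolding carrier_free_Abelian_group_iff
    proof (induction rule: frag_induction)
      case zero
      show ?case using \<epsilon>_diff[of 0 0] by simp
    next
      case (one p)
      then obtain d w where p: "p = (d, w)" "d \<in> carrier C" "w \<in> W" by blast
      then show ?case
        using pure[of d w] pure[of "c \<otimes>\<^bsub>C\<^esub> d" w] c 0 C.m_closed[OF c p(2)]
        by (simp add: pure_def) (simp add: smooth_ring_ops)
    next
      case (diff a b)
      then have ab: "a \<in> carrier G" "b \<in> carrier G" by simp_all
      then show ?case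
        using diff \<epsilon>_diff[OF ab] \<epsilon>_diff[OF scale_closed[OF c ab(1)] scale_closed[OF c ab(2)]]
          carrier_G_diff[OF ab]
        by (simp add: right_diff_distrib)
    qed
    then show ?thesis
      using x by (simp add: tensor_module_smult[OF c] del: carrier_free_Abelian_group_iff)
  qed
  then show thesis using hom pure that by blast
qed

lemma (in graded_space) long_antimono: "j \<le> k \<Longrightarrow> long k \<subseteq> long j"
  unfolding long_def by (rule A.add.mono_generate) (force simp: monoms_def)

text \<open>Stated for \<open>long 3\<close>, which contains the third step of the polynomial
  filtration and has explicit additive generators on which divisibility can be tested.\<close>

lemma prod_notin_long:
  fixes k :: int
  defines "V \<equiv> \<lambda>_::int. UNIV :: real set"
  assumes k: "even k" "k > 0"
  obtains e f where "e \<in> gen_component V k" "f \<in> gen_component V (- k)"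
    "sym_gen V e \<otimes>\<^bsub>sym_algebra V\<^esub> sym_gen V f \<notin> graded_space.long V 3"
proof -
  interpret graded_space V
    by unfold_locales (simp add: V_def)
  interpret tp: tensor_pair "V 0" "V i" for i
    by (rule tensor_pair_V)
  obtain \<epsilon> where \<epsilon>: "\<epsilon> \<in> hom (add_monoid (tensor_module (V 0) (V 0))) (add_monoid class_ring)"
    and \<epsilon>_smult: "\<And>c X. c \<in> carrier C \<Longrightarrow> X \<in> carrier (tensor_module (V 0) (V 0)) \<Longrightarrow> \<epsilon> (c \<odot>\<^bsub>tensor_module (V 0) (V 0)\<^esub> X) = c 0 * \<epsilon> X"
    and \<epsilon>_pure: "\<And>c w. c \<in> carrier C \<Longrightarrow> w \<in> V 0 \<Longrightarrow> \<epsilon> (tp.pure 0 c w) = c 0 * w"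
    using tp.evaluation_functional[of "\<lambda>x. x" 0] linear_ident by blast
  \<comment> \<open>All components of \<open>V\<close> coincide, so the tensor modules in different
    weights are literally the same and the single functional \<epsilon> applies in every
    weight.\<close>
  have V_eq: "V i = V 0" for i by (simp add: V_def)
  let ?N = "tensor_module (V 0) (V 0)"
  have N: "module C ?N" by (rule tp.module_tensor_module)
  then interpret N: module C ?N .
  have \<epsilon>_add: "\<epsilon> (X \<oplus>\<^bsub>?N\<^esub> Y) = \<epsilon> X + \<epsilon> Y" if "X \<in> carrier ?N" "Y \<in> carrier ?N" for X Y
    using \<epsilon> that by (simp add: hom_def)
  have \<epsilon>_zero: "\<epsilon> \<zero>\<^bsub>?N\<^esub> = 0"
    using \<epsilon>_add[of "\<zero>\<^bsub>?N\<^esub>" "\<zero>\<^bsub>?N\<^esub>"] by simp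
  have comp: "m i \<in> carrier ?N" if "m \<in> carrier M" "i \<noteq> 0" for m i
  proof -
    have "m i \<in> carrier (tensor_module (V 0) (V i))"
      using that by (auto simp: gen_module_def direct_sum_carrier_iff)
    then show ?thesis by (simp only: V_eq[of i])
  qed
  \<comment> \<open>Adding the coordinates in weights \<open>k\<close> and \<open>- k\<close> gives
    one linear functional that takes the value 1 on both chosen generators.\<close>
  define \<mu> where "\<mu> m = \<epsilon> (m k) + \<epsilon> (m (- k))" for m :: "real mod_elem"
  define g :: "real mod_elem \<Rightarrow> real poly" where "g m = [:0, \<mu> m:]" for m
  define \<gamma> :: "real fn \<Rightarrow> real poly" where "\<gamma> c = [:c 0:]" for c
  have k0: "k \<noteq> 0" "- k \<noteq> 0" using k by auto
  have g_add: "g (m \<oplus>\<^bsub>M\<^esub> n) = g m + g n" if "m \<in> carrier M" "n \<in> carrier M" for m n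
    using that k0 V_eq[of k] V_eq[of "- k"] comp
    by (simp add: g_def \<mu>_def gen_module_def direct_sum_simps \<epsilon>_add)
  have g_smult: "g (c \<odot>\<^bsub>M\<^esub> m) = \<gamma> c * g m" if "c \<in> carrier C" "m \<in> carrier M" for c m
    using that k0 V_eq[of k] V_eq[of "- k"] comp
    by (simp add: g_def \<gamma>_def \<mu>_def gen_module_def direct_sum_simps \<epsilon>_smult algebra_simps)
  \<comment> \<open>This settles the sign rule: for two odd weights both sides vanish, and in all
    other cases there is no sign and polynomials commute.\<close>
  have g_odd: "g m = 0" if "m \<in> gen_component V i" "odd i" for m i
  proof -
    have "i \<noteq> k" "i \<noteq> - k" using k that(2) by auto
    then have "m k = \<zero>\<^bsub>?N\<^esub>" "m (- k) = \<zero>\<^bsub>?N\<^esub>"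
      using that(1) k0 V_eq[of k] V_eq[of "- k"] by (auto simp: gen_component_def)
    then show ?thesis by (simp add: g_def \<mu>_def \<epsilon>_zero)
  qed
  obtain h where h: "h \<in> ring_hom A class_ring"
    and h_const: "\<And>c. c \<in> carrier C \<Longrightarrow> h (sym_const V c) = \<gamma> c"
    and h_gen: "\<And>m. m \<in> carrier M \<Longrightarrow> h (sym_gen V m) = g m"
  proof (rule sym_algebra_universal[of class_ring \<gamma> g])
    show "\<gamma> \<in> ring_hom C class_ring"
      by (rule ring_hom_memI) (auto simp: \<gamma>_def smooth_ring_ops V_def)
  next
    fix i j v w assume "v \<in> gen_component V i" "w \<in> gen_component V j"
    then show "g v \<otimes>\<^bsub>class_ring\<^esub> g w = (if odd i \<and> odd j then \<ominus>\<^bsub>class_ring\<^esub> (g w \<otimes>\<^bsub>class_ring\<^esub> g v) else g w \<otimes>\<^bsub>class_ring\<^esub> g v)"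
      using g_odd class_ring.minus_zero by (auto simp: mult.commute)
  qed (auto simp: class_ring.ring_axioms g_add g_smult mult.commute)
  interpret h: ring_hom_ring A class_ring h
    by (intro ring_hom_ringI2 A.ring_axioms class_ring.ring_axioms h)
  let ?X = "[:0, 1:] :: real poly"
  \<comment> \<open>Every letter, whatever its weight, goes to a multiple of X, possibly zero; hence
    each letter of a monomial contributes a factor X to its image.\<close>
  have h_long: "?X ^ p dvd h x" if "x \<in> long p" for p x
  proof -
    have gp: "?X ^ length xs dvd h (gen_prod xs)" if "homogeneous xs" for xs
      using that
    proof (induction xs)
      case (Cons x xs)
      have "?X dvd g (snd x)"
        by (simp add: g_def dvd_iff_poly_eq_0)
      moreover have "?X ^ length xs dvd h (gen_prod xs)"
        using Cons by simp
      moreover have "h (gen_prod (x # xs)) = g (snd x) * h (gen_prod xs)"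
        using Cons.prems gen_component_closed[of "snd x" "fst x"] by (simp add: h_gen gen_prod_closed)
      ultimately show ?case
        using mult_dvd_mono[of ?X "g (snd x)" "?X ^ length xs"] by (simp only: list.size power_Suc add_0_right add_Suc_right)
    qed simp
    have "?X ^ p dvd h x" if x: "x \<in> monoms p s" for x s
    proof -
      obtain c xs where "c \<in> carrier C" "homogeneous xs" "p \<le> length xs" "x = sym_const V c \<otimes>\<^bsub>A\<^esub> gen_prod xs"
        using x by (auto simp: monoms_def)
      moreover from this have "?X ^ p dvd h (gen_prod xs)"
        using gp le_imp_power_dvd dvd_trans by blast
      ultimately show ?thesis
        by (simp add: gen_prod_closed)
    qed
    then have "long p \<subseteq> {r \<in> carrier A. h r \<in> {q. ?X ^ p dvd q}}"
      unfolding long_def using monoms_closed(2)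
      by (intro A.add_generate_sub[OF monoms_closed(2)] ideal.axioms(1)[OF h.ideal_vimage[OF ideal_class_ring_dvd]]) blast
    then show ?thesis using that by blast
  qed
  \<comment> \<open>The tensor of the constant function 1 with the basis vector 1 of the real line,
    placed in weight \<open>i\<close>.\<close>
  define z where "z i = (\<lambda>j\<in>-{0}. if j = i then tp.pure 0 \<one>\<^bsub>C\<^esub> 1 else \<zero>\<^bsub>tensor_module (V 0) (V j)\<^esub>)" for i :: int
  have pure: "tp.pure 0 \<one>\<^bsub>C\<^esub> 1 \<in> carrier ?N"
    by (rule tp.pure_closed[OF C.one_closed]) (simp add: V_def)
  have z: "z i \<in> gen_component V i" if "i \<noteq> 0" for i
  proof -
    have "finite {j \<in> -{0}. (if j = i then tp.pure 0 \<one>\<^bsub>C\<^esub> 1 else \<zero>\<^bsub>tensor_module (V 0) (V j)\<^esub>)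
        \<noteq> \<zero>\<^bsub>tensor_module (V 0) (V j)\<^esub>}"
      by (rule finite_subset[of _ "{i}"]) auto
    moreover have "\<zero>\<^bsub>tensor_module (V 0) (V j)\<^esub> \<in> carrier (tensor_module (V 0) (V j))" for j
      using N.zero_closed by (simp only: V_eq[of j])
    moreover have "tp.pure 0 \<one>\<^bsub>C\<^esub> 1 \<in> carrier (tensor_module (V 0) (V i))"
      using pure by (simp only: V_eq[of i])
    ultimately have "z i \<in> carrier M"
      by (auto simp: z_def gen_module_def direct_sum_carrier_iff cong: conj_cong)
    then show ?thesis by (auto simp: z_def gen_component_def)
  qed
  have gz: "g (z i) = ?X" if "i = k \<or> i = - k" for i
  proof -
    have "\<epsilon> (tp.pure 0 \<one>\<^bsub>C\<^esub> 1) = 1"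
      using \<epsilon>_pure[OF C.one_closed, of 1] by (simp add: V_def smooth_ring_ops)
    moreover have "\<epsilon> \<zero>\<^bsub>tensor_module (V 0) (V j)\<^esub> = 0" for j
      using \<epsilon>_zero by (simp only: V_eq[of j])
    ultimately show ?thesis
      using that k0 k by (auto simp: g_def \<mu>_def z_def)
  qed
  have "h (sym_gen V (z k) \<otimes>\<^bsub>A\<^esub> sym_gen V (z (- k))) = ?X * ?X"
    using z[OF k0(1)] z[OF k0(2)] gz[of k] gz[of "- k"] gen_component_closed by (simp add: h_gen)
  moreover have "\<not> ?X ^ 3 dvd ?X * ?X"
    using dvd_imp_degree_le[of "?X ^ 3" "?X * ?X"] by (auto simp: degree_power_eq)
  ultimately have "\<not> ?X ^ 3 dvd h (sym_gen V (z k) \<otimes>\<^bsub>A\<^esub> sym_gen V (z (- k)))"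
    by simp
  then have "sym_gen V (z k) \<otimes>\<^bsub>A\<^esub> sym_gen V (z (- k)) \<notin> graded_space.long V 3"
    using h_long by blast
  then show thesis
    using that z k0 by blast
qed

theorem not_weight_filtration_le_pol_filtration:
  defines "V \<equiv> \<lambda>_::int. UNIV :: real set"
  shows "\<not> filtration_le
     (induced_filtration (weight_filtration V) (weight_component V 0))
     (induced_filtration (pol_filtration V) (weight_component V 0))"
proof
  interpret graded_space V
    by unfold_locales (simp add: V_def)
  assume "filtration_le
     (induced_filtration (weight_filtration V) (weight_component V 0))
     (induced_filtration (pol_filtration V) (weight_component V 0))"
  then obtain l :: "nat \<Rightarrow> nat" where l: "mono l" "\<not> bdd_above (range l)"
    and sub: "\<And>k. weight_filtration V k \<inter> weight_component V 0 \<subseteq> pol_filtration V (l k) \<inter> weight_component V 0"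
    by (auto simp: filtration_le_def induced_filtration_def)
  \<comment> \<open>Reaching 3 is enough for a contradiction, because the products of two generators
    stay outside \<open>long 3\<close> however large their weights are.\<close>
  obtain n where n: "3 \<le> l n"
    using l(2) by (metis bdd_above.I2 nle_le)
  \<comment> \<open>Even and positive, as the homomorphism to polynomials requires, and at least
    \<open>n\<close>, so that monotonicity gives \<open>3 \<le> l k\<close>.\<close>
  define k where "k = 2 * (n + 1)"
  have lk: "3 \<le> l k"
    using monoD[OF l(1), of n k] n by (simp add: k_def)
  obtain e f where e: "e \<in> gen_component V (int k)" and f: "f \<in> gen_component V (- int k)"
    and notin: "sym_gen V e \<otimes>\<^bsub>A\<^esub> sym_gen V f \<notin> graded_space.long V 3"
    using prod_notin_long[of "int k"] unfolding V_def k_def by auto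
  have ef: "homogeneous [(int k, e)]" "homogeneous [(- int k, f)]" "homogeneous [(int k, e), (- int k, f)]"
    using e f by (auto simp: k_def)
  have cl: "sym_gen V e \<in> carrier A" "sym_gen V f \<in> carrier A"
    using e f gen_component_closed by auto
  have "sym_gen V e \<otimes>\<^bsub>A\<^esub> sym_gen V f \<in> weight_component V 0"
    using const_gen_prod_in_long_weight[OF C.one_closed ef(3), of 0] cl
    by (simp add: weight_component_eq ring_hom_one[OF sym_const_hom])
  moreover have "sym_gen V e \<in> weight_component V (int k)"
    using const_gen_prod_in_long_weight[OF C.one_closed ef(1), of 0] cl
    by (simp add: weight_component_eq ring_hom_one[OF sym_const_hom])
  then have "sym_gen V e \<otimes>\<^bsub>A\<^esub> sym_gen V f \<in> weight_filtration V k"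
    using weight_component_subset_filtration[of k "int k"] cl
    by (auto intro!: ideal.I_r_closed[OF weight_filtration_ideal])
  ultimately have "sym_gen V e \<otimes>\<^bsub>A\<^esub> sym_gen V f \<in> pol_filtration V (l k)"
    using sub by blast
  then show False
    using notin pol_filtration_subset_long long_antimono[OF lk] by blast
qed

theorem mainTheorem3:
  shows "(\<forall>V :: int \<Rightarrow> 'v::real_vector set. graded_vector_space V \<longrightarrow>
            (\<forall>r. filtration_le
                   (induced_filtration (pol_filtration V) (weight_component V r))
                   (induced_filtration (weight_filtration V) (weight_component V r)))) \<and>
         (\<exists>(V :: int \<Rightarrow> real set) r. graded_vector_space V \<and>
            \<not> filtration_le
                   (induced_filtration (weight_filtration V) (weight_component V r))
                   (induced_filtration (pol_filtration V) (weight_component V r)))"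
proof (intro conjI allI impI)
  fix V :: "int \<Rightarrow> 'v set" and r
  assume "graded_vector_space V"
  then interpret graded_space V
    by unfold_locales (simp add: graded_vector_space_def)
  show "filtration_le (induced_filtration (pol_filtration V) (weight_component V r))
      (induced_filtration (weight_filtration V) (weight_component V r))"
    by (rule pol_filtration_le_weight_filtration)
next
  have "span {1} = (UNIV :: real set)"
    by (auto simp: span_singleton)
  then have "graded_vector_space (\<lambda>_. UNIV :: real set)"
    unfolding graded_vector_space_def by (auto intro: exI[of _ "{1}"])
  then show "\<exists>(V :: int \<Rightarrow> real set) r. graded_vector_space V \<and>
      \<not> filtration_le (induced_filtration (weight_filtration V) (weight_component V r))
          (induced_filtration (pol_filtration V) (weight_component V r))"
    using not_weight_filtration_le_pol_filtration by blast
qed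

end
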